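(* Suppose that a linear partial monitoring game (with domain $\mathcal D$ and Legendre potential $F$ satisfying the standing assumptions in the context) has an $(\alpha,\beta,\lambda)$ adaptive information ratio and that $\beta$ is bounded. Then, for any $\eta>0$ and $q\in\mathcal D\cap\operatorname{dom}(\nabla F)$, $$\inf_{p\in\mathcal P_+,\,g\in\mathcal G}\ \sup_{a^*\in\mathcal D,\,z\in\mathcal Z}\left[\Lambda_{q,\eta}(z,a^*,p,g)-\left(1-\frac1\lambda\right)\left(\frac\eta\lambda\right)^{\frac1{\lambda-1}}\sum_{a\in\mathcal A}p(a)\beta(z,a)\right]\le\alpha.$$
   Context: A linear partial monitoring game is given by an action set $\mathcal A\subset\mathbb R^d$, a signal set $\Sigma$, a latent set $\mathcal Z$, a signal function $\Phi:\mathcal A\times\mathcal Z\to\Sigma$, written $\Phi_a(z)$, and a loss function $\ell:\mathcal Z\to[0,1]^d$. Standing assumptions. $F:\mathbb R^d\to\mathbb R\cup\{\infty\}$ is Legendre (proper, convex, lower semi-continuous, essentially smooth and essentially strictly convex). $\mathcal D\subset\operatorname{conv}(\mathcal A)$ is compact, convex and has non-empty relative interior. Moreover: (a) $1<|\mathcal A|<\infty$; (b) $\langle a,\ell(z)\rangle\in[0,1]$ for all $a\in\mathcal A$, $z\in\mathcal Z$; (c) $\mathcal D\subset\operatorname{dom}(F)=\{x:F(x)<\infty\}$; (d) $\operatorname{diam}(\mathcal D)=\sup_{x,y\in\mathcal D}(F(x)-F(y))<\infty$. Notation. $\mathcal P$ is the set of probability distributions on $\mathcal A$ and $\mathcal P_+=\{p\in\mathcal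 P: p(a)>0\ \forall a\in\mathcal A\}$. $F^\star(u)=\sup_{x\in\mathbb R^d}\langle u,x\rangle-F(x)$. Bregman divergences: $\operatorname{D}(p,q)=F(p)-F(q)-\langle\nabla F(q),p-q\rangle$ and $\operatorname{D}_\star(x,y)=F^\star(x)-F^\star(y)-\langle\nabla F^\star(y),x-y\rangle$. If $F$ is not differentiable at $q$, then $\langle\nabla F(q),p-q\rangle$ is read as the one-sided directional derivative $\lim_{h\to0^+}(F(q+h(p-q))-F(q))/h$. $\operatorname{dom}(\nabla F)$ is the set where $F$ is differentiable. For $q\in\mathcal D\cap\operatorname{dom}(\nabla F)$, $\Psi_q(x)=\operatorname{D}_\star(\nabla F(q)-x,\nabla F(q))$. $\mathcal V$ is the set of finitely supported probability distributions on $\mathcal Z\times\mathcal D$. $\mathcal G$ is the set of all functions from $\mathcal A\times\Sigma$ to $\mathbb R^d$. Adaptive information ratio. Let $\alpha\in\mathbb R$, $\beta:\mathcal Z\times\mathcal A\to[0,\infty)$ and $\lambda>1$. The game has an $(\alpha,\beta,\lambda)$ adaptive information ratio if for all $\nu\in\mathcal V$ there exists $p\in\mathcal P$ such that when $(Z,A^*,A)$ has law $\nu\otimes p$ (i.e. $(Z,A^* )\sim\nu$ and $A\sim p$ independently), $$\mathbb E[\langle A-A^*,\ell(Z)\rangle]\le\alpha+\big(\mathbb E[\beta(Z,A)]\big)^{1-1/\lambda}\,\big(\mathbb E[\operatorname{D}(\mathbb E[A^*\mid\Phi_A(Z),A],\mathbb E[A^*])]\big)^{1/\lambda}.$$ Objective.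 For $z\in\mathcal Z$, $a^*\in\mathcal D$, $p\in\mathcal P_+$, $g\in\mathcal G$, $$\Lambda_{q,\eta}(z,a^*,p,g)=\sum_{a\in\mathcal A}p(a)\langle a-a^*,\ell(z)\rangle+\Big\langle a^*-q,\sum_{a\in\mathcal A}g(a,\Phi_a(z))\Big\rangle+\frac1\eta\sum_{a\in\mathcal A}p(a)\Psi_q\left(\frac{\eta g(a,\Phi_a(z))}{p(a)}\right).$$ *)

theory Defs
  imports "HOL-Probability.Probability"
begin

section \<open>Extended-real-valued convex functions\<close>

definition edom :: "('v \<Rightarrow> ereal) \<Rightarrow> 'v set" where
  "edom F = {x. F x < \<infinity>}"

definition proper_fun :: "('v \<Rightarrow> ereal) \<Rightarrow> bool" where
  "proper_fun F \<longleftrightarrow> edom F \<noteq> {} \<and> (\<forall>x. F x \<noteq> -\<infinity>)"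

definition convex_fun :: "('v::real_vector \<Rightarrow> ereal) \<Rightarrow> bool" where
  "convex_fun F \<longleftrightarrow> convex {(x, t::real). F x \<le> ereal t}"

definition lsc_fun :: "('v::topological_space \<Rightarrow> ereal) \<Rightarrow> bool" where
  "lsc_fun F \<longleftrightarrow> (\<forall>x. F x \<le> Liminf (at x) F)"

text \<open>Differentiability at \<open>x\<close> requires \<open>F\<close> to be finite near \<open>x\<close>, hence the interior.\<close>

definition has_gradient :: "('v::euclidean_space \<Rightarrow> ereal) \<Rightarrow> 'v \<Rightarrow> 'v \<Rightarrow> bool" where
  "has_gradient F x g \<longleftrightarrow>
     x \<in> interior (edom F) \<and> GDERIV (\<lambda>y. real_of_ereal (F y)) x :> g"

definition dom_grad :: "('v::euclidean_space \<Rightarrow> ereal) \<Rightarrow> 'v set" where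
  "dom_grad F = {x. \<exists>g. has_gradient F x g}"

definition grad :: "('v::euclidean_space \<Rightarrow> ereal) \<Rightarrow> 'v \<Rightarrow> 'v" where
  "grad F x = (THE g. has_gradient F x g)"

definition subdifferential :: "('v::real_inner \<Rightarrow> ereal) \<Rightarrow> 'v \<Rightarrow> 'v set" where
  "subdifferential F x = {g. \<forall>y. F x + ereal (g \<bullet> (y - x)) \<le> F y}"

text \<open>Essential smoothness and essential strict convexity are understood as in Rockafellar,
  \<^emph>\<open>Convex Analysis\<close>, Section 26.\<close>

definition essentially_smooth :: "('v::euclidean_space \<Rightarrow> ereal) \<Rightarrow> bool" where
  "essentially_smooth F \<longleftrightarrow>
     interior (edom F) \<noteq> {} \<and>
     interior (edom F) \<subseteq> dom_grad F \<and>
     (\<forall>X x. (\<forall>n::nat. X n \<in> interior (edom F)) \<longrightarrow> X \<longlonglongrightarrow> x \<longrightarrow>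
        x \<in> frontier (interior (edom F)) \<longrightarrow>
        filterlim (\<lambda>n. norm (grad F (X n))) at_top sequentially)"

definition essentially_strictly_convex :: "('v::real_inner \<Rightarrow> ereal) \<Rightarrow> bool" where
  "essentially_strictly_convex F \<longleftrightarrow>
     (\<forall>C. convex C \<longrightarrow> C \<subseteq> {x. subdifferential F x \<noteq> {}} \<longrightarrow>
        (\<forall>x\<in>C. \<forall>y\<in>C. \<forall>t::real. x \<noteq> y \<longrightarrow> 0 < t \<longrightarrow> t < 1 \<longrightarrow>
           F ((1 - t) *\<^sub>R x + t *\<^sub>R y) < ereal (1 - t) * F x + ereal t * F y))"

definition legendre :: "('v::euclidean_space \<Rightarrow> ereal) \<Rightarrow> bool" where
  "legendre F \<longleftrightarrow> proper_fun F \<and> convex_fun F \<and> lsc_fun F \<and>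
     essentially_smooth F \<and> essentially_strictly_convex F"

definition fenchel :: "('v::real_inner \<Rightarrow> ereal) \<Rightarrow> 'v \<Rightarrow> ereal" where
  "fenchel F u = (SUP x. ereal (u \<bullet> x) - F x)"

definition dir_deriv :: "('v::real_normed_vector \<Rightarrow> ereal) \<Rightarrow> 'v \<Rightarrow> 'v \<Rightarrow> ereal" where
  "dir_deriv F q v = Lim (at_right 0) (\<lambda>h::real. (F (q + h *\<^sub>R v) - F q) / ereal h)"

definition bregman :: "('v::euclidean_space \<Rightarrow> ereal) \<Rightarrow> 'v \<Rightarrow> 'v \<Rightarrow> ereal" where
  "bregman F p q = F p - F q -
     (if q \<in> dom_grad F then ereal (grad F q \<bullet> (p - q)) else dir_deriv F q (p - q))"

definition Psi :: "('v::euclidean_space \<Rightarrow> ereal) \<Rightarrow> 'v \<Rightarrow> 'v \<Rightarrow> ereal" where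
  "Psi F q x = bregman (fenchel F) (grad F q - x) (grad F q)"

section \<open>Linear partial monitoring games\<close>

text \<open>\<open>A\<close> is the action set, \<open>S\<close> the signal set, \<open>Zs\<close> the latent set, \<open>\<Phi>\<close> the signal function,
  \<open>loss\<close> the loss function, \<open>D\<close> the domain and \<open>F\<close> the potential.\<close>

locale linear_pm_game =
  fixes A :: "(real ^ 'd) set"
    and S :: "'s set"
    and Zs :: "'z set"
    and \<Phi> :: "real ^ 'd \<Rightarrow> 'z \<Rightarrow> 's"
    and loss :: "'z \<Rightarrow> real ^ 'd"
    and D :: "(real ^ 'd) set"
    and F :: "real ^ 'd \<Rightarrow> ereal"
  assumes signal: "\<And>a z. a \<in> A \<Longrightarrow> z \<in> Zs \<Longrightarrow> \<Phi> a z \<in> S"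
    and loss_range: "\<And>z i. z \<in> Zs \<Longrightarrow> loss z $ i \<in> {0..1}"
    and finite_actions: "finite A"
    and card_actions: "1 < card A"
    and inner_loss: "\<And>a z. a \<in> A \<Longrightarrow> z \<in> Zs \<Longrightarrow> a \<bullet> loss z \<in> {0..1}"
    and legendre: "legendre F"
    and domain_subset: "D \<subseteq> convex hull A"
    and compact_domain: "compact D"
    and convex_domain: "convex D"
    and rel_interior_domain: "rel_interior D \<noteq> {}"
    and domain_dom: "D \<subseteq> edom F"
    and diam_finite: "(SUP (x, y)\<in>D \<times> D. F x - F y) < \<infinity>"

definition distributions :: "'v set \<Rightarrow> 'v pmf set" where
  "distributions A = {p. set_pmf p \<subseteq> A}"

definition pos_distributions :: "'v set \<Rightarrow> 'v pmf set" where
  "pos_distributions A = {p \<in> distributions A. \<forall>a\<in>A. 0 < pmf p a}"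

definition finite_priors :: "'z set \<Rightarrow> 'v set \<Rightarrow> ('z \<times> 'v) pmf set" where
  "finite_priors Zs D = {\<nu>. finite (set_pmf \<nu>) \<and> set_pmf \<nu> \<subseteq> Zs \<times> D}"

definition estimators :: "'v set \<Rightarrow> 's set \<Rightarrow> ('v \<times> 's \<Rightarrow> 'v) set" where
  "estimators A S = (A \<times> S) \<rightarrow>\<^sub>E UNIV"

text \<open>\<open>cond_exp_pmf M X Y \<omega>\<close> is the value at \<open>\<omega>\<close> of \<open>E[X | Y]\<close> under the discrete law \<open>M\<close>; it is
  meaningful for \<open>\<omega> \<in> set_pmf M\<close>, where the conditioning event has positive probability.\<close>

definition cond_exp_pmf ::
    "'w pmf \<Rightarrow> ('w \<Rightarrow> 'v::{banach, second_countable_topology}) \<Rightarrow> ('w \<Rightarrow> 'y) \<Rightarrow> 'w \<Rightarrow> 'v" where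
  "cond_exp_pmf M X Y \<omega> = measure_pmf.expectation (cond_pmf M {\<omega>'. Y \<omega>' = Y \<omega>}) X"

text \<open>Expectation of an extended-real random variable under a finitely supported law.\<close>

definition ereal_expectation :: "'w pmf \<Rightarrow> ('w \<Rightarrow> ereal) \<Rightarrow> ereal" where
  "ereal_expectation M X = (\<Sum>\<omega>\<in>set_pmf M. ereal (pmf M \<omega>) * X \<omega>)"

text \<open>Positive powers of elements of \<open>[0, \<infinity>]\<close>.\<close>

definition epowr :: "ereal \<Rightarrow> real \<Rightarrow> ereal" where
  "epowr x r = (if x = \<infinity> then \<infinity> else ereal (real_of_ereal x powr r))"

text \<open>Outcomes of \<open>pair_pmf \<nu> p\<close> are triples \<open>((z, a\<^sup>*), a)\<close>.\<close>

definition adaptive_information_ratio ::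
    "(real ^ 'd) set \<Rightarrow> 'z set \<Rightarrow> (real ^ 'd \<Rightarrow> 'z \<Rightarrow> 's) \<Rightarrow> ('z \<Rightarrow> real ^ 'd) \<Rightarrow>
     (real ^ 'd) set \<Rightarrow> (real ^ 'd \<Rightarrow> ereal) \<Rightarrow>
     real \<Rightarrow> ('z \<Rightarrow> real ^ 'd \<Rightarrow> real) \<Rightarrow> real \<Rightarrow> bool" where
  "adaptive_information_ratio A Zs \<Phi> loss D F \<alpha> \<beta> lam \<longleftrightarrow>
     (\<forall>\<nu>\<in>finite_priors Zs D. \<exists>p\<in>distributions A.
        let M = pair_pmf \<nu> p;
            Astar = (\<lambda>((z, a'), a). a');
            obs = (\<lambda>((z, a'), a). (\<Phi> a z, a))
        in ereal (measure_pmf.expectation M (\<lambda>((z, a'), a). (a - a') \<bullet> loss z))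
           \<le> ereal \<alpha>
             + ereal (measure_pmf.expectation M (\<lambda>((z, a'), a). \<beta> z a) powr (1 - 1 / lam))
               * epowr (ereal_expectation M (\<lambda>\<omega>.
                     bregman F (cond_exp_pmf M Astar obs \<omega>) (measure_pmf.expectation M Astar)))
                   (1 / lam))"

definition objective ::
    "(real ^ 'd) set \<Rightarrow> (real ^ 'd \<Rightarrow> 'z \<Rightarrow> 's) \<Rightarrow> ('z \<Rightarrow> real ^ 'd) \<Rightarrow> (real ^ 'd \<Rightarrow> ereal) \<Rightarrow>
     real ^ 'd \<Rightarrow> real \<Rightarrow> 'z \<Rightarrow> real ^ 'd \<Rightarrow> (real ^ 'd) pmf \<Rightarrow>
     ((real ^ 'd) \<times> 's \<Rightarrow> real ^ 'd) \<Rightarrow> ereal" where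
  "objective A \<Phi> loss F q \<eta> z a' p g =
     ereal (\<Sum>a\<in>A. pmf p a * ((a - a') \<bullet> loss z))
     + ereal ((a' - q) \<bullet> (\<Sum>a\<in>A. g (a, \<Phi> a z)))
     + ereal (1 / \<eta>) *
         (\<Sum>a\<in>A. ereal (pmf p a) * Psi F q ((\<eta> / pmf p a) *\<^sub>R g (a, \<Phi> a z)))"

end

theory Submission
  imports Defs
begin

text \<open>Writing \<open>w = \<nabla>F(q) - \<eta> g(a, \<sigma>) / p(a)\<close>, the objective becomes
  \<open>\<Sum>\<^sub>a p(a) (\<langle>a - a\<^sup>*, \<ell>(z)\<rangle> + (F\<^sup>\<star>(w) - \<langle>a\<^sup>*, w\<rangle> + F(q) + \<langle>\<nabla>F(q), a\<^sup>* - q\<rangle>) / \<eta>)\<close>, which is convexlike in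
  \<open>(p, w)\<close> and affine in \<open>a\<^sup>*\<close>. Once \<open>w\<close> is confined to a compact set, a minimax theorem of Ky Fan
  type reduces the claim to a Bayesian one: for every finitely supported prior some strategy has
  expected penalised payoff at most \<open>\<alpha>\<close>. There \<open>w = \<nabla>F(E[A\<^sup>* | \<Phi>\<^sub>A(Z), A])\<close> turns the last term into
  \<open>- E[D(E[A\<^sup>* | \<Phi>\<^sub>A(Z), A], q)] / \<eta>\<close>, which is at most \<open>- E[D(E[A\<^sup>* | \<Phi>\<^sub>A(Z), A], E[A\<^sup>*])] / \<eta>\<close>, and
  Young's inequality absorbs the right-hand side of the information ratio.

  Gradients of \<open>F\<close> blow up at the boundary of its domain, so the minimax theorem is applied with
  \<open>a\<^sup>*\<close> ranging over \<open>(1 - \<epsilon>) D + \<epsilon> q\<close>, on which they are bounded. Since the payoff is affine in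
  \<open>a\<^sup>*\<close> and bounded below at \<open>a\<^sup>* = q\<close> (here \<open>\<beta>\<close> has to be bounded), this costs \<open>O(\<epsilon>)\<close>. Mixing \<open>p\<close>
  with the uniform distribution finally makes it positive.\<close>

section \<open>Gradients and conjugates of Legendre functions\<close>

lemma has_gradient_unique:
  assumes "has_gradient F x g" "has_gradient F x g'"
  shows "g' = g"
proof -
  have "(\<lambda>h. h \<bullet> g') = (\<lambda>h. h \<bullet> g)"
    using assms has_derivative_unique unfolding has_gradient_def gderiv_def by blast
  then show ?thesis by (metis inner_commute vector_eq_rdot)
qed

lemma grad_eqI: "has_gradient F x g \<Longrightarrow> grad F x = g"
  unfolding grad_def using has_gradient_unique by (metis the_equality)

lemma has_gradient_grad: "x \<in> dom_grad F \<Longrightarrow> has_gradient F x (grad F x)"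
  using grad_eqI by (fastforce simp: dom_grad_def)

context
  fixes F :: "'v::euclidean_space \<Rightarrow> ereal"
  assumes proper: "proper_fun F" and conv: "convex_fun F"
begin

lemma edom_real: "x \<in> edom F \<Longrightarrow> F x = ereal (real_of_ereal (F x))"
  using proper by (cases "F x") (auto simp: edom_def proper_fun_def)

text \<open>The epigraph definition of convexity yields a real-valued convex function on the
  effective domain. Mixing the epigraph points over \<open>x\<close> and \<open>y\<close> at their
  exact heights gives both the inequality and the convexity of \<open>edom F\<close>.\<close>

lemma convex_on_edom: "convex_on (edom F) (\<lambda>x. real_of_ereal (F x))"
proof (rule convex_onI)
  have key: "F ((1 - t) *\<^sub>R x + t *\<^sub>R y)
      \<le> ereal ((1 - t) * real_of_ereal (F x) + t * real_of_ereal (F y))"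
    if "x \<in> edom F" "y \<in> edom F" "0 \<le> t" "t \<le> 1" for x y and t :: real
  proof -
    have "(1 - t) *\<^sub>R (x, real_of_ereal (F x)) + t *\<^sub>R (y, real_of_ereal (F y))
        \<in> {(x, t::real). F x \<le> ereal t}"
      using conv that edom_real unfolding convex_fun_def
      by (intro convexD) auto
    then show ?thesis by simp
  qed
  show "real_of_ereal (F ((1 - t) *\<^sub>R x + t *\<^sub>R y))
      \<le> (1 - t) * real_of_ereal (F x) + t * real_of_ereal (F y)"
    if "0 < t" "t < 1" "x \<in> edom F" "y \<in> edom F" for x y and t :: real
  proof -
    have "(1 - t) *\<^sub>R x + t *\<^sub>R y \<in> edom F"
      using key[of x y t] that unfolding edom_def by (auto simp: le_less_trans)
    then show ?thesis
      using key[of x y t] that edom_real[of "(1 - t) *\<^sub>R x + t *\<^sub>R y"]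
      by (metis ereal_less_eq(3) less_imp_le)
  qed
  show "convex (edom F)"
    unfolding convex_alt
  proof (intro ballI allI impI)
    fix x y and t :: real
    assume "x \<in> edom F" "y \<in> edom F" "0 \<le> t \<and> t \<le> 1"
    then show "(1 - t) *\<^sub>R x + t *\<^sub>R y \<in> edom F"
      using key[of x y t] unfolding edom_def by (auto simp: le_less_trans)
  qed
qed

lemma convex_edom: "convex (edom F)"
  using convex_on_edom by (rule convex_on_imp_convex)

lemma dom_grad_interior: "x \<in> dom_grad F \<Longrightarrow> x \<in> interior (edom F)"
  by (auto simp: dom_grad_def has_gradient_def)

lemma dom_grad_edom: "x \<in> dom_grad F \<Longrightarrow> x \<in> edom F"
  using dom_grad_interior interior_subset by blast

text \<open>By convexity each difference quotient from \<open>x\<close> towards \<open>y\<close> is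
  at most \<open>F y - F x\<close>, and these quotients converge to the directional derivative as
  the step decreases to 0.\<close>

lemma gradient_inequality:
  assumes g: "has_gradient F x g" and y: "y \<in> edom F"
  shows "real_of_ereal (F x) + g \<bullet> (y - x) \<le> real_of_ereal (F y)"
proof -
  let ?f = "\<lambda>x. real_of_ereal (F x)"
  let ?\<phi> = "\<lambda>t::real. ?f (x + t *\<^sub>R (y - x))"
  have x: "x \<in> edom F" using g interior_subset by (auto simp: has_gradient_def)
  have "(?f has_derivative (\<lambda>h. h \<bullet> g)) (at (x + 0 *\<^sub>R (y - x)))"
    using g by (simp add: has_gradient_def gderiv_def)
  moreover have "((\<lambda>t::real. x + t *\<^sub>R (y - x)) has_derivative (\<lambda>t. t *\<^sub>R (y - x))) (at 0)"
    by (auto intro!: derivative_eq_intros)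
  ultimately have "(?\<phi> has_derivative (\<lambda>t. (t *\<^sub>R (y - x)) \<bullet> g)) (at 0)"
    by (rule has_derivative_compose[rotated])
  then have "DERIV ?\<phi> 0 :> (y - x) \<bullet> g"
    by (simp add: has_field_derivative_def mult_commute_abs)
  then have lim: "((\<lambda>h. (?\<phi> h - ?\<phi> 0) / h) \<longlongrightarrow> (y - x) \<bullet> g) (at_right 0)"
    unfolding has_field_derivative_iff using filterlim_at_split by (auto simp: filterlim_at_split)
  have "\<forall>\<^sub>F h in at_right 0. (?\<phi> h - ?\<phi> 0) / h \<le> ?f y - ?f x"
  proof -
    have "(?\<phi> h - ?\<phi> 0) / h \<le> ?f y - ?f x" if h: "0 < h" "h < 1" for h
    proof -
      have "?f ((1 - h) *\<^sub>R x + h *\<^sub>R y) \<le> (1 - h) * ?f x + h * ?f y"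
        using convex_onD[OF convex_on_edom, of h x y] h x y by auto
      moreover have "(1 - h) *\<^sub>R x + h *\<^sub>R y = x + h *\<^sub>R (y - x)"
        by (simp add: algebra_simps)
      ultimately have "?\<phi> h - ?\<phi> 0 \<le> (?f y - ?f x) * h"
        by (simp add: algebra_simps)
      then show ?thesis using h by (simp add: pos_divide_le_eq)
    qed
    then show ?thesis
      unfolding eventually_at_right_field by (intro exI[of _ 1]) auto
  qed
  then have "(y - x) \<bullet> g \<le> ?f y - ?f x"
    by (intro tendsto_upperbound[OF lim]) auto
  then show ?thesis by (simp add: inner_commute)
qed

section \<open>Strict growth above tangents and the Fenchel conjugate\<close>

lemma fenchel_le:
  assumes "\<And>x. x \<in> edom F \<Longrightarrow> w \<bullet> x - real_of_ereal (F x) \<le> r"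
  shows "fenchel F w \<le> ereal r"
  unfolding fenchel_def
proof (rule SUP_least)
  fix x show "ereal (w \<bullet> x) - F x \<le> ereal r"
  proof (cases "x \<in> edom F")
    case True
    then obtain s where s: "F x = ereal s" using edom_real by blast
    then show ?thesis using assms[OF True] by simp
  next
    case False
    then show ?thesis by (simp add: edom_def)
  qed
qed

lemma fenchel_ge:
  assumes "x \<in> edom F"
  shows "ereal (w \<bullet> x - real_of_ereal (F x)) \<le> fenchel F w"
proof -
  obtain s where s: "F x = ereal s" using assms edom_real by blast
  then show ?thesis unfolding fenchel_def
    by (intro SUP_upper2[of x]) auto
qed

text \<open>If the tangent at \<open>q\<close> touched the graph again at \<open>x\<close>, then
  convexity from above and the gradient inequality from below would make \<open>F\<close> affine on
  the whole segment. There \<open>u\<close> would be a subgradient at every point, so essential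
  strict convexity applies to the segment and fails at its midpoint.\<close>

lemma gradient_excess_pos:
  assumes strict: "essentially_strictly_convex F" and g: "has_gradient F q u"
    and x: "x \<in> edom F" "x \<noteq> q"
  shows "real_of_ereal (F q) + u \<bullet> (x - q) < real_of_ereal (F x)"
proof (rule ccontr)
  let ?f = "\<lambda>x. real_of_ereal (F x)"
  have q: "q \<in> edom F" using g interior_subset by (auto simp: has_gradient_def)
  assume "\<not> ?thesis"
  then have fx: "?f x = ?f q + u \<bullet> (x - q)" using gradient_inequality[OF g x(1)] by simp
  have seg: "(1 - t) *\<^sub>R q + t *\<^sub>R x \<in> edom F \<and>
      ?f ((1 - t) *\<^sub>R q + t *\<^sub>R x) = ?f q + u \<bullet> ((1 - t) *\<^sub>R q + t *\<^sub>R x - q)"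
    if t: "0 \<le> t" "t \<le> 1" for t
  proof -
    let ?y = "(1 - t) *\<^sub>R q + t *\<^sub>R x"
    have y: "?y \<in> edom F" using convexD_alt[OF convex_edom q x(1), of t] t by auto
    have "?f ?y \<le> (1 - t) * ?f q + t * ?f x"
      using convex_onD[OF convex_on_edom, of t q x] t x q by auto
    also have "\<dots> = ?f q + u \<bullet> (?y - q)" unfolding fx by (simp add: algebra_simps)
    finally show ?thesis using gradient_inequality[OF g y] y by simp
  qed
  have "closed_segment q x \<subseteq> {y. subdifferential F y \<noteq> {}}"
  proof
    fix y assume "y \<in> closed_segment q x"
    then obtain t where t: "0 \<le> t" "t \<le> 1" "y = (1 - t) *\<^sub>R q + t *\<^sub>R x"
      by (auto simp: closed_segment_def)
    with seg have y: "y \<in> edom F" "?f y = ?f q + u \<bullet> (y - q)" by auto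
    have "F y + ereal (u \<bullet> (v - y)) \<le> F v" for v
    proof (cases "v \<in> edom F")
      case True
      then have "?f y + u \<bullet> (v - y) \<le> ?f v"
        using gradient_inequality[OF g True] y(2) by (simp add: algebra_simps)
      then show ?thesis using edom_real[OF True] edom_real[OF y(1)]
        by (metis ereal_less_eq(3) plus_ereal.simps(1))
    next
      case False then show ?thesis by (simp add: edom_def)
    qed
    then show "y \<in> {y. subdifferential F y \<noteq> {}}" by (auto simp: subdifferential_def)
  qed
  then have "F ((1 - 1/2) *\<^sub>R q + (1/2::real) *\<^sub>R x) < ereal (1 - 1/2) * F q + ereal (1/2) * F x"
    using strict[unfolded essentially_strictly_convex_def, rule_format,
        of "closed_segment q x" q x "1/2"] x(2) by auto
  moreover have "F ((1 - 1/2) *\<^sub>R q + (1/2::real) *\<^sub>R x) = ereal (?f ((1 - 1/2) *\<^sub>R q + (1/2) *\<^sub>R x))"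
    by (rule edom_real, rule conjunct1, rule seg) auto
  moreover have "ereal (1 - 1/2) * F q + ereal (1/2) * F x = ereal ((1 - 1/2) * ?f q + 1/2 * ?f x)"
    using edom_real[OF q] edom_real[OF x(1)] by (metis plus_ereal.simps(1) times_ereal.simps(1))
  ultimately have "?f ((1 - 1/2) *\<^sub>R q + (1/2) *\<^sub>R x) < (1 - 1/2) * ?f q + 1/2 * ?f x"
    by (metis less_ereal.simps(1))
  moreover have "?f ((1 - 1/2) *\<^sub>R q + (1/2) *\<^sub>R x) = ?f q + u \<bullet> ((1 - 1/2) *\<^sub>R q + (1/2) *\<^sub>R x - q)"
    using seg[of "1/2"] by auto
  ultimately show False using fx by (simp add: algebra_simps)
qed

text \<open>A positive minimum on a small sphere propagates outwards by convexity along rays, so the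
  lower semicontinuity of \<open>F\<close> is not needed.\<close>

lemma gradient_excess_growth:
  assumes strict: "essentially_strictly_convex F" and g: "has_gradient F q u"
    and e: "0 < e" "cball q e \<subseteq> interior (edom F)"
  obtains c where "0 < c"
    "\<And>x. x \<in> edom F \<Longrightarrow> e \<le> norm (x - q) \<Longrightarrow>
       c * norm (x - q) \<le> real_of_ereal (F x) - real_of_ereal (F q) - u \<bullet> (x - q)"
proof -
  let ?f = "\<lambda>x. real_of_ereal (F x)"
  let ?d = "\<lambda>x. ?f x - ?f q - u \<bullet> (x - q)"
  have q: "q \<in> edom F" using g interior_subset by (auto simp: has_gradient_def)
  have sub: "sphere q e \<subseteq> interior (edom F)" using e(2) by (auto simp: cball_def sphere_def)
  have "continuous_on (interior (edom F)) ?f"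
    by (intro convex_on_continuous open_interior
        convex_on_subset[OF convex_on_edom interior_subset] convex_interior convex_edom)
  then have "continuous_on (sphere q e) ?d"
    using sub by (auto intro!: continuous_intros intro: continuous_on_subset)
  moreover have "sphere q e \<noteq> {}" using e(1) by simp
  ultimately obtain s where s: "s \<in> sphere q e" "\<forall>y\<in>sphere q e. ?d s \<le> ?d y"
    using continuous_attains_inf[OF compact_sphere, of q e ?d] by blast
  have "s \<in> edom F" using s(1) sub interior_subset by blast
  moreover have "s \<noteq> q" using s(1) e(1) by auto
  ultimately have pos: "0 < ?d s" using gradient_excess_pos[OF strict g, of s] by simp
  show ?thesis
  proof (rule that[of "?d s / e"])
    show "0 < ?d s / e" using pos e(1) by simp
    fix x assume x: "x \<in> edom F" "e \<le> norm (x - q)"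
    \<comment> \<open>With this \<open>t\<close> the point \<open>?y\<close> is where the ray from
      \<open>q\<close> through \<open>x\<close> meets the sphere.\<close>
    define t where "t = e / norm (x - q)"
    have n: "0 < norm (x - q)" using x(2) e(1) by linarith
    have t: "0 \<le> t" "t \<le> 1" using x(2) e(1) n by (auto simp: t_def)
    let ?y = "(1 - t) *\<^sub>R q + t *\<^sub>R x"
    have yq: "?y - q = t *\<^sub>R (x - q)" by (simp add: algebra_simps)
    have "?y \<in> sphere q e"
      using e(1) n yq by (simp add: dist_norm norm_minus_commute[of q] t_def)
    then have "?d s \<le> ?d ?y" using s(2) by blast
    also have "\<dots> \<le> t * ?d x"
      using convex_onD[OF convex_on_edom, of t q x] t x q unfolding yq by (simp add: algebra_simps)
    finally have "?d s \<le> t * ?d x" .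
    moreover have "0 < t" using e(1) n by (simp add: t_def)
    ultimately have "?d s / t \<le> ?d x" by (simp only: pos_divide_le_eq mult.commute)
    then show "?d s / e * norm (x - q) \<le> ?d x" by (simp add: t_def)
  qed
qed

text \<open>Perturbing \<open>u\<close> by a small \<open>h\<close> cannot move the near-maximisers
  of \<open>u \<bullet> x - F x\<close> far from \<open>q\<close>. So the conjugate at
  \<open>u + h\<close> lies between \<open>?v + h \<bullet> q\<close> and
  \<open>?v + h \<bullet> q + e * norm h\<close> for every \<open>e > 0\<close> and small
  \<open>h\<close>, which is differentiability with gradient \<open>q\<close>.\<close>

lemma fenchel_has_gradient:
  assumes strict: "essentially_strictly_convex F" and g: "has_gradient F q u"
  shows "has_gradient (fenchel F) u q"
    and "fenchel F u = ereal (u \<bullet> q - real_of_ereal (F q))"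
proof -
  let ?f = "\<lambda>x. real_of_ereal (F x)"
  let ?v = "u \<bullet> q - ?f q"
  have q: "q \<in> edom F" using g interior_subset by (auto simp: has_gradient_def)
  obtain \<rho> where \<rho>: "0 < \<rho>" "cball q \<rho> \<subseteq> interior (edom F)"
    using g open_contains_cball[of "interior (edom F)"] by (auto simp: has_gradient_def)
  have bound: "\<exists>c>0. \<forall>h. norm h \<le> c \<longrightarrow>
      ereal (?v + h \<bullet> q) \<le> fenchel F (u + h) \<and> fenchel F (u + h) \<le> ereal (?v + h \<bullet> q + e * norm h)"
    if e: "0 < e" for e
  proof -
    define e' where "e' = min e \<rho>"
    have e': "0 < e'" "cball q e' \<subseteq> interior (edom F)" "e' \<le> e"
      using e \<rho> by (auto simp: e'_def)
    obtain c where c: "0 < c" "\<And>x. x \<in> edom F \<Longrightarrow> e' \<le> norm (x - q) \<Longrightarrow>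
       c * norm (x - q) \<le> ?f x - ?f q - u \<bullet> (x - q)"
      using gradient_excess_growth[OF strict g e'(1,2)] by metis
    have "ereal (?v + h \<bullet> q) \<le> fenchel F (u + h)" for h
      using fenchel_ge[OF q, of "u + h"] by (simp add: algebra_simps)
    moreover have "fenchel F (u + h) \<le> ereal (?v + h \<bullet> q + e * norm h)" if h: "norm h \<le> c" for h
    proof (rule fenchel_le)
      fix x assume x: "x \<in> edom F"
      have hx: "h \<bullet> (x - q) \<le> norm h * norm (x - q)" by (rule norm_cauchy_schwarz)
      \<comment> \<open>Far from \<open>q\<close> the linear growth of the excess absorbs the
        perturbation; near \<open>q\<close> the excess is nonnegative and the perturbation is at
        most \<open>e * norm h\<close>.\<close>
      have "h \<bullet> (x - q) - (?f x - ?f q - u \<bullet> (x - q)) \<le> e * norm h"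
      proof (cases "e' \<le> norm (x - q)")
        case True
        have "norm h * norm (x - q) \<le> c * norm (x - q)" using h by (simp add: mult_right_mono)
        moreover have "0 \<le> e * norm h" using e by simp
        ultimately show ?thesis using c(2)[OF x True] hx by linarith
      next
        case False
        then have "norm h * norm (x - q) \<le> norm h * e" using e'(3) by (simp add: mult_left_mono)
        then show ?thesis using hx gradient_inequality[OF g x] by (simp add: mult.commute)
      qed
      then show "(u + h) \<bullet> x - ?f x \<le> ?v + h \<bullet> q + e * norm h" by (simp add: algebra_simps)
    qed
    ultimately show ?thesis using c(1) by blast
  qed
  show val: "fenchel F u = ereal ?v"
  proof -
    obtain c where "0 < c" "\<And>h. norm h \<le> c \<Longrightarrow> ereal (?v + h \<bullet> q) \<le> fenchel F (u + h)"
      "\<And>h. norm h \<le> c \<Longrightarrow> fenchel F (u + h) \<le> ereal (?v + h \<bullet> q + 1 * norm h)"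
      using bound[of 1] by auto
    from this(2,3)[of 0] this(1) show ?thesis by (simp add: order_antisym)
  qed
  have "u \<in> interior (edom (fenchel F))"
  proof -
    obtain c where c: "0 < c" "\<And>h. norm h \<le> c \<Longrightarrow> fenchel F (u + h) \<le> ereal (?v + h \<bullet> q + 1 * norm h)"
      using bound[of 1] by auto
    have "ball u c \<subseteq> edom (fenchel F)"
    proof
      fix y assume "y \<in> ball u c"
      then have "norm (y - u) \<le> c" by (simp add: dist_norm norm_minus_commute)
      from c(2)[OF this] show "y \<in> edom (fenchel F)" by (auto simp: edom_def)
    qed
    then show ?thesis using c(1) by (meson centre_in_ball interior_maximal open_ball subsetD)
  qed
  moreover have "((\<lambda>y. real_of_ereal (fenchel F y)) has_derivative (\<lambda>h. h \<bullet> q)) (at u)"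
    unfolding has_derivative_at_alt
  proof (intro conjI allI impI)
    show "bounded_linear (\<lambda>h. h \<bullet> q)" by (rule bounded_linear_inner_left)
    fix e :: real assume e: "0 < e"
    obtain c where c: "0 < c" "\<And>h. norm h \<le> c \<Longrightarrow> ereal (?v + h \<bullet> q) \<le> fenchel F (u + h)"
      "\<And>h. norm h \<le> c \<Longrightarrow> fenchel F (u + h) \<le> ereal (?v + h \<bullet> q + e * norm h)"
      using bound[OF e] by auto
    show "\<exists>d>0. \<forall>y. norm (y - u) < d \<longrightarrow>
        norm (real_of_ereal (fenchel F y) - real_of_ereal (fenchel F u) - (y - u) \<bullet> q) \<le> e * norm (y - u)"
    proof (intro exI[of _ c] conjI allI impI c(1))
      fix y assume "norm (y - u) < c"
      then have "ereal (?v + (y - u) \<bullet> q) \<le> fenchel F y"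
        "fenchel F y \<le> ereal (?v + (y - u) \<bullet> q + e * norm (y - u))"
        using c(2,3)[of "y - u"] by auto
      then show "norm (real_of_ereal (fenchel F y) - real_of_ereal (fenchel F u) - (y - u) \<bullet> q)
          \<le> e * norm (y - u)"
        unfolding val by (cases "fenchel F y") auto
    qed
  qed
  ultimately show "has_gradient (fenchel F) u q"
    by (simp add: has_gradient_def gderiv_def)
qed

text \<open>As the conjugate has gradient \<open>q\<close> at \<open>grad F q\<close>, the
  divergence collapses to the conjugate at \<open>w\<close> plus \<open>F q - w \<bullet> q\<close>.
  It is stated for any upper bound \<open>r\<close> of the conjugate because strategies carry such a
  bound instead of the exact value.\<close>

lemma Psi_le:
  assumes strict: "essentially_strictly_convex F" and q: "q \<in> dom_grad F"
    and w: "\<And>x. x \<in> edom F \<Longrightarrow> w \<bullet> x - real_of_ereal (F x) \<le> r"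
  shows "Psi F q (grad F q - w) \<le> ereal (r + real_of_ereal (F q) - w \<bullet> q)"
proof -
  note g = has_gradient_grad[OF q]
  note fg = fenchel_has_gradient[OF strict g]
  have dg: "grad F q \<in> dom_grad (fenchel F)" using fg(1) by (auto simp: dom_grad_def)
  have "grad (fenchel F) (grad F q) = q" using fg(1) by (rule grad_eqI)
  moreover have "fenchel F w \<le> ereal r" by (rule fenchel_le) (rule w)
  with fenchel_ge[OF dom_grad_edom[OF q], of w] obtain s where "fenchel F w = ereal s" "s \<le> r"
    by (cases "fenchel F w") auto
  ultimately show ?thesis
    using dg fg(2) by (simp add: Psi_def bregman_def algebra_simps inner_commute)
qed

end

text \<open>Since \<open>q\<close> is interior, a shrunk point is the centre of a ball of radius
  \<open>\<epsilon> * \<rho>\<close> on which \<open>F\<close> is bounded above, with a radius and a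
  bound common to all \<open>d\<close>. A steep gradient would violate that bound at the edge of the
  ball. The second component of the pair is the conjugate at \<open>grad F x\<close>, so the pair is
  what a strategy stores.\<close>

lemma grad_bounded_on_shrunk:
  fixes F :: "'v::euclidean_space \<Rightarrow> ereal"
  assumes F: "proper_fun F" "convex_fun F" "essentially_smooth F"
    and D: "bounded D" "D \<subseteq> edom F" "\<And>x. x \<in> D \<Longrightarrow> real_of_ereal (F x) \<le> M"
    and q: "q \<in> D" "q \<in> dom_grad F" and e: "0 < \<epsilon>" "\<epsilon> \<le> 1"
  obtains R where "\<And>d. d \<in> D \<Longrightarrow> (1 - \<epsilon>) *\<^sub>R d + \<epsilon> *\<^sub>R q \<in> dom_grad F"
    "\<And>d x. d \<in> D \<Longrightarrow> x = (1 - \<epsilon>) *\<^sub>R d + \<epsilon> *\<^sub>R q \<Longrightarrow>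
      norm (grad F x, grad F x \<bullet> x - real_of_ereal (F x)) \<le> R"
proof -
  let ?f = "\<lambda>x. real_of_ereal (F x)"
  note convF = convex_on_edom[OF F(1,2)]
  note gq = has_gradient_grad[OF q(2)]
  obtain K where K: "\<And>x. x \<in> D \<Longrightarrow> norm x \<le> K" using D(1) by (auto simp: bounded_iff)
  have qi: "q \<in> interior (edom F)" using q(2) by (rule dom_grad_interior[OF F(1,2)])
  obtain \<rho> where \<rho>: "0 < \<rho>" "cball q \<rho> \<subseteq> interior (edom F)"
    using qi open_contains_cball[of "interior (edom F)"] by auto
  have "continuous_on (interior (edom F)) ?f"
    by (intro convex_on_continuous open_interior
        convex_on_subset[OF convF interior_subset] convex_interior convex_edom[OF F(1,2)])
  then have "continuous_on (cball q \<rho>) ?f" using \<rho>(2) continuous_on_subset by blast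
  moreover have "cball q \<rho> \<noteq> {}" using \<rho>(1) by simp
  ultimately obtain s where s: "\<forall>y\<in>cball q \<rho>. ?f y \<le> ?f s"
    using continuous_attains_sup[OF compact_cball, of q \<rho> ?f] by blast
  define M' where "M' = max M (?f s)"
  \<comment> \<open>\<open>L\<close> bounds the absolute value of \<open>F\<close> on the shrunk
    set: from above through \<open>M'\<close>, from below through the tangent at
    \<open>q\<close>.\<close>
  define L where "L = \<bar>M'\<bar> + \<bar>?f q\<bar> + norm (grad F q) * (2 * K)"
  have dg: "(1 - \<epsilon>) *\<^sub>R d + \<epsilon> *\<^sub>R q \<in> dom_grad F" if d: "d \<in> D" for d
  proof -
    have "d - \<epsilon> *\<^sub>R (d - q) \<in> interior (edom F)"
      using mem_interior_convex_shrink[OF convex_edom[OF F(1,2)] qi _ e] d D(2) by blast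
    then show ?thesis using F(3) by (auto simp: essentially_smooth_def algebra_simps)
  qed
  have "norm (grad F x, grad F x \<bullet> x - ?f x) \<le> 2 * L / (\<epsilon> * \<rho>) + (2 * L / (\<epsilon> * \<rho>) * K + L)"
    if d: "d \<in> D" and x_def: "x = (1 - \<epsilon>) *\<^sub>R d + \<epsilon> *\<^sub>R q" for d x
  proof -
    have x: "x \<in> dom_grad F" unfolding x_def by (rule dg[OF d])
    note xe = dom_grad_edom[OF F(1,2) x]
    have nx: "norm x \<le> K"
    proof -
      have "norm x \<le> (1 - \<epsilon>) * norm d + \<epsilon> * norm q"
        unfolding x_def using e by (intro norm_triangle_le) auto
      also have "\<dots> \<le> (1 - \<epsilon>) * K + \<epsilon> * K"
        using K[OF d] K[OF q(1)] e by (intro add_mono mult_left_mono) auto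
      finally show ?thesis by (simp add: algebra_simps)
    qed
    have upper: "?f ((1 - \<epsilon>) *\<^sub>R d + \<epsilon> *\<^sub>R y) \<le> M' \<and> (1 - \<epsilon>) *\<^sub>R d + \<epsilon> *\<^sub>R y \<in> edom F"
      if y: "y \<in> cball q \<rho>" for y
    proof -
      have ye: "y \<in> edom F" using y \<rho>(2) interior_subset by blast
      have de: "d \<in> edom F" using d D(2) by blast
      have "?f ((1 - \<epsilon>) *\<^sub>R d + \<epsilon> *\<^sub>R y) \<le> (1 - \<epsilon>) * ?f d + \<epsilon> * ?f y"
        using convex_onD[OF convF, of \<epsilon> d y] ye de e by auto
      also have "\<dots> \<le> (1 - \<epsilon>) * M' + \<epsilon> * M'"
        using D(3)[OF d] bspec[OF s y] e by (intro add_mono mult_left_mono) (auto simp: M'_def)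
      finally show ?thesis
        using convexD_alt[OF convex_edom[OF F(1,2)] de ye, of \<epsilon>] e by (simp add: algebra_simps)
    qed
    have fx: "\<bar>?f x\<bar> \<le> L"
    proof -
      have "0 \<le> K" using nx norm_ge_zero[of x] by linarith
      have "?f x \<le> M'" unfolding x_def using upper[of q] \<rho>(1) by simp
      moreover have "?f q + grad F q \<bullet> (x - q) \<le> ?f x"
        by (rule gradient_inequality[OF F(1,2) gq xe])
      moreover have "\<bar>grad F q \<bullet> (x - q)\<bar> \<le> norm (grad F q) * norm (x - q)"
        by (rule Cauchy_Schwarz_ineq2)
      moreover have "norm (x - q) \<le> 2 * K"
        using nx K[OF q(1)] norm_triangle_ineq4[of x q] by linarith
      then have "norm (grad F q) * norm (x - q) \<le> norm (grad F q) * (2 * K)"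
        by (intro mult_left_mono) auto
      ultimately show ?thesis unfolding L_def by linarith
    qed
    \<comment> \<open>Moving \<open>q\<close> by \<open>\<rho>\<close> in the direction of the
      gradient at \<open>x\<close> moves \<open>x\<close> by \<open>\<epsilon> * \<rho>\<close> in
      that direction, the worst case for the gradient inequality.\<close>
    let ?y = "q + \<rho> *\<^sub>R sgn (grad F x)"
    have "?y \<in> cball q \<rho>" using \<rho>(1) by (simp add: dist_norm norm_sgn)
    note up = upper[OF this]
    have shift: "(1 - \<epsilon>) *\<^sub>R d + \<epsilon> *\<^sub>R ?y - x = (\<epsilon> * \<rho>) *\<^sub>R sgn (grad F x)"
      by (simp add: x_def algebra_simps)
    have "?f x + grad F x \<bullet> ((\<epsilon> * \<rho>) *\<^sub>R sgn (grad F x)) \<le> M'"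
      using gradient_inequality[OF F(1,2) has_gradient_grad[OF x], of "(1 - \<epsilon>) *\<^sub>R d + \<epsilon> *\<^sub>R ?y"] up
      unfolding shift by linarith
    moreover have "grad F x \<bullet> sgn (grad F x) = norm (grad F x)"
      by (cases "grad F x = 0") (auto simp: sgn_div_norm dot_square_norm power2_eq_square)
    moreover have "M' \<le> L"
      using nx norm_ge_zero[of x] unfolding L_def
      by (smt (verit) mult_nonneg_nonneg norm_ge_zero)
    ultimately have "norm (grad F x) * (\<epsilon> * \<rho>) \<le> 2 * L"
      using abs_ge_minus_self[of "?f x"] fx
      by (simp only: inner_scaleR_right mult.commute[of "norm (grad F x)"])
    then have gx: "norm (grad F x) \<le> 2 * L / (\<epsilon> * \<rho>)"
      using e \<rho>(1) by (simp add: pos_le_divide_eq)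
    have "\<bar>grad F x \<bullet> x\<bar> \<le> norm (grad F x) * norm x" by (rule Cauchy_Schwarz_ineq2)
    also have "\<dots> \<le> 2 * L / (\<epsilon> * \<rho>) * K" using gx nx
      by (intro mult_mono) (auto intro: order_trans[OF norm_ge_zero])
    finally have "norm (grad F x \<bullet> x - ?f x) \<le> 2 * L / (\<epsilon> * \<rho>) * K + L"
      using fx unfolding real_norm_def by linarith
    then show ?thesis using gx norm_Pair_le[of "grad F x" "grad F x \<bullet> x - ?f x"] by linarith
  qed
  then show ?thesis using that dg by blast
qed

section \<open>A minimax theorem\<close>

text \<open>The two-function case separates a subset of the plane from the negative quadrant; the weight
  \<open>t\<close> is the largest lower bound forced by the points with \<open>k x < 0\<close>.\<close>

lemma convexlike_pair:
  fixes h k :: "'x \<Rightarrow> real"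
  assumes convexlike: "\<And>x1 x2 t. x1 \<in> X \<Longrightarrow> x2 \<in> X \<Longrightarrow> 0 \<le> t \<Longrightarrow> t \<le> 1 \<Longrightarrow>
      \<exists>x\<in>X. h x \<le> (1 - t) * h x1 + t * h x2 \<and> k x \<le> (1 - t) * k x1 + t * k x2"
    and cover: "\<And>x. x \<in> X \<Longrightarrow> 0 \<le> h x \<or> 0 \<le> k x"
  shows "\<exists>t\<ge>0. t \<le> 1 \<and> (\<forall>x\<in>X. 0 \<le> t * h x + (1 - t) * k x)"
proof -
  \<comment> \<open>Points with negative \<open>k\<close> bound the weight from below, points with
    negative \<open>h\<close> bound it from above. The element 0 keeps the supremum defined and
    nonnegative when there are no points of the first kind.\<close>
  define L where "L = insert 0 ((\<lambda>x. - k x / (h x - k x)) ` {x\<in>X. k x < 0})"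
  \<comment> \<open>This says that every lower bound on the weight is at most every upper bound.
    Otherwise some \<open>t\<close> lies strictly between \<open>k x1 / b\<close> and
    \<open>- h x1 / a\<close>, and mixing \<open>x1\<close> and \<open>x2\<close> with it makes both
    functions negative at a point of \<open>X\<close>.\<close>
  have cross: "k x2 * h x1 \<le> k x1 * h x2"
    if x: "x1 \<in> X" "x2 \<in> X" "h x1 < 0" "k x2 < 0" for x1 x2
  proof (rule ccontr)
    assume less: "\<not> ?thesis"
    have k1: "0 \<le> k x1" and h2: "0 \<le> h x2" using cover[OF x(1)] cover[OF x(2)] x by auto
    define a where "a = h x2 - h x1"
    define b where "b = k x1 - k x2"
    have ab: "0 < a" "0 < b" using k1 h2 x by (auto simp: a_def b_def)
    have lt: "k x1 / b < - h x1 / a"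
      using less ab by (simp add: divide_simps a_def b_def algebra_simps)
    then obtain t where t2: "k x1 / b < t" and t1: "t < - h x1 / a" using dense by blast
    have "0 \<le> k x1 / b" using k1 ab by simp
    moreover have "- h x1 / a \<le> 1" using ab h2 by (simp only: pos_divide_le_eq) (simp add: a_def)
    ultimately have "0 \<le> t" "t \<le> 1" using t1 t2 by linarith+
    from convexlike[OF x(1,2) this] obtain y where y: "y \<in> X"
      "h y \<le> (1 - t) * h x1 + t * h x2" "k y \<le> (1 - t) * k x1 + t * k x2" by blast
    have "t * a < - h x1" using t1 ab(1) by (simp only: pos_less_divide_eq)
    moreover have "k x1 < t * b" using t2 ab(2) by (simp only: pos_divide_less_eq)
    ultimately have "h y < 0" "k y < 0" using y(2,3) by (auto simp: a_def b_def algebra_simps)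
    then show False using cover[OF y(1)] by auto
  qed
  have L1: "l \<le> 1" if "l \<in> L" for l
    using that cover by (fastforce simp: L_def divide_simps)
  then have bdd: "bdd_above L" by (meson bdd_aboveI)
  define t where "t = Sup L"
  have t0: "0 \<le> t" unfolding t_def by (rule cSup_upper[OF _ bdd]) (simp add: L_def)
  have t1: "t \<le> 1" unfolding t_def by (rule cSup_least) (auto simp: L_def L1[unfolded L_def])
  have "0 \<le> t * h x + (1 - t) * k x" if x: "x \<in> X" for x
  proof -
    consider "0 \<le> h x" "0 \<le> k x" | "h x < 0" "0 \<le> k x" | "0 \<le> h x" "k x < 0"
      using cover[OF x] by linarith
    then show ?thesis
    proof cases
      case 1 then show ?thesis using t0 t1 by simp
    next
      case 2
      have "t \<le> k x / (k x - h x)"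
        unfolding t_def
      proof (rule cSup_least)
        show "L \<noteq> {}" by (simp add: L_def)
        fix l assume "l \<in> L"
        then consider "l = 0" | y where "y \<in> X" "k y < 0" "l = - k y / (h y - k y)"
          by (auto simp: L_def)
        then show "l \<le> k x / (k x - h x)"
        proof cases
          case 1 then show ?thesis using 2 by simp
        next
          case (2 y)
          have "0 \<le> h y" using cover[OF 2(1)] 2(2) by auto
          then have pos: "0 < h y - k y" "0 < k x - h x" using 2(2) \<open>h x < 0\<close> \<open>0 \<le> k x\<close> by auto
          show ?thesis unfolding 2(3)
            using cross[OF x 2(1) \<open>h x < 0\<close> 2(2)]
            by (simp only: pos_divide_le_eq[OF pos(1)] times_divide_eq_left
                pos_le_divide_eq[OF pos(2)]) (simp add: algebra_simps)
        qed
      qed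
      then have "t * (k x - h x) \<le> k x" using 2 by (simp add: pos_le_divide_eq)
      then show ?thesis by (simp add: algebra_simps)
    next
      case 3
      have "- k x / (h x - k x) \<le> t"
        unfolding t_def using x 3 by (intro cSup_upper bdd) (auto simp: L_def)
      moreover have "0 < h x - k x" using 3 by simp
      ultimately have "- k x \<le> t * (h x - k x)" by (simp only: pos_divide_le_eq)
      then show ?thesis by (simp add: algebra_simps)
    qed
  qed
  then show ?thesis using t0 t1 by blast
qed

text \<open>Induction on \<open>T\<close>. The points at which \<open>y0\<close> fails form a
  convexlike set \<open>X'\<close> still covered by the other indices, so the induction hypothesis
  gives weights with nonnegative average \<open>h\<close> on \<open>X'\<close>. Then
  \<open>h\<close> and \<open>f x y0\<close> are never both negative, and the two-function case
  combines them. Since \<open>X'\<close> is smaller than \<open>X\<close>, the induction must leave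
  \<open>X\<close> arbitrary.\<close>

lemma convexlike_finite:
  fixes f :: "'x \<Rightarrow> 'y \<Rightarrow> real"
  assumes "finite T" "T \<noteq> {}"
    and "\<And>x1 x2 t. x1 \<in> X \<Longrightarrow> x2 \<in> X \<Longrightarrow> 0 \<le> t \<Longrightarrow> t \<le> 1 \<Longrightarrow>
      \<exists>x\<in>X. \<forall>y\<in>T. f x y \<le> (1 - t) * f x1 y + t * f x2 y"
    and "\<And>x. x \<in> X \<Longrightarrow> \<exists>y\<in>T. 0 \<le> f x y"
  shows "\<exists>\<nu>. (\<forall>y\<in>T. 0 \<le> \<nu> y) \<and> sum \<nu> T = 1 \<and> (\<forall>x\<in>X. 0 \<le> (\<Sum>y\<in>T. \<nu> y * f x y))"
  using assms
proof (induction T arbitrary: X rule: finite_ne_induct)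
  case (singleton y)
  then show ?case by (intro exI[of _ "\<lambda>_. 1"]) auto
next
  case (insert y0 T)
  note convexlike = insert.prems(1) and cover = insert.prems(2)
  define X' where "X' = {x\<in>X. f x y0 < 0}"
  have "\<exists>\<nu>. (\<forall>y\<in>T. 0 \<le> \<nu> y) \<and> sum \<nu> T = 1 \<and> (\<forall>x\<in>X'. 0 \<le> (\<Sum>y\<in>T. \<nu> y * f x y))"
  proof (rule insert.IH)
    show "\<exists>y\<in>T. 0 \<le> f x y" if "x \<in> X'" for x
      using cover[of x] that by (auto simp: X'_def)
    fix x1 x2 and t :: real
    assume x: "x1 \<in> X'" "x2 \<in> X'" and t: "0 \<le> t" "t \<le> 1"
    then obtain x where "x \<in> X" "\<forall>y\<in>insert y0 T. f x y \<le> (1 - t) * f x1 y + t * f x2 y"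
      using convexlike[of x1 x2 t] by (auto simp: X'_def)
    moreover have "(1 - t) * f x1 y0 + t * f x2 y0 < 0"
      using x t convex_bound_lt[of "f x1 y0" 0 "f x2 y0" "1 - t" t] by (auto simp: X'_def)
    ultimately show "\<exists>x\<in>X'. \<forall>y\<in>T. f x y \<le> (1 - t) * f x1 y + t * f x2 y"
      by (intro bexI[of _ x]) (auto simp: X'_def intro: le_less_trans)
  qed
  then obtain \<mu> where \<mu>: "\<And>y. y \<in> T \<Longrightarrow> 0 \<le> \<mu> y" "sum \<mu> T = 1"
    "\<And>x. x \<in> X' \<Longrightarrow> 0 \<le> (\<Sum>y\<in>T. \<mu> y * f x y)" by blast
  define h where "h x = (\<Sum>y\<in>T. \<mu> y * f x y)" for x
  have "\<exists>t\<ge>0. t \<le> 1 \<and> (\<forall>x\<in>X. 0 \<le> t * h x + (1 - t) * f x y0)"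
  proof (rule convexlike_pair)
    show "0 \<le> h x \<or> 0 \<le> f x y0" if "x \<in> X" for x
      using \<mu>(3)[of x] that by (auto simp: X'_def h_def)
    fix x1 x2 and t :: real
    assume "x1 \<in> X" "x2 \<in> X" "0 \<le> t" "t \<le> 1"
    then obtain x where x: "x \<in> X" "\<forall>y\<in>insert y0 T. f x y \<le> (1 - t) * f x1 y + t * f x2 y"
      using convexlike[of x1 x2 t] by auto
    have "h x \<le> (\<Sum>y\<in>T. \<mu> y * ((1 - t) * f x1 y + t * f x2 y))"
      unfolding h_def using x(2) \<mu>(1) by (intro sum_mono mult_left_mono) auto
    also have "\<dots> = (\<Sum>y\<in>T. (1 - t) * (\<mu> y * f x1 y) + t * (\<mu> y * f x2 y))"
      by (intro sum.cong) (auto simp: algebra_simps)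
    also have "\<dots> = (1 - t) * h x1 + t * h x2"
      by (simp add: h_def sum_distrib_left sum.distrib)
    finally show "\<exists>x\<in>X. h x \<le> (1 - t) * h x1 + t * h x2 \<and>
        f x y0 \<le> (1 - t) * f x1 y0 + t * f x2 y0"
      using x by auto
  qed
  then obtain t where t: "0 \<le> t" "t \<le> 1" "\<And>x. x \<in> X \<Longrightarrow> 0 \<le> t * h x + (1 - t) * f x y0" by blast
  define \<nu> where "\<nu> y = (if y = y0 then 1 - t else t * \<mu> y)" for y
  have on_T: "(\<Sum>y\<in>T. \<nu> y * c y) = t * (\<Sum>y\<in>T. \<mu> y * c y)" for c
    unfolding sum_distrib_left using insert.hyps by (intro sum.cong) (auto simp: \<nu>_def)
  show ?case
  proof (intro exI[of _ \<nu>] conjI ballI)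
    show "0 \<le> \<nu> y" if "y \<in> insert y0 T" for y using that t \<mu>(1) by (auto simp: \<nu>_def)
    show "sum \<nu> (insert y0 T) = 1"
      using on_T[of "\<lambda>_. 1"] insert.hyps \<mu>(2) by (simp add: \<nu>_def)
    show "0 \<le> (\<Sum>y\<in>insert y0 T. \<nu> y * f x y)" if "x \<in> X" for x
      using on_T[of "f x"] insert.hyps t(3)[OF that] by (simp add: \<nu>_def h_def)
  qed
qed

lemma pmf_of_weights:
  assumes "finite T" "\<And>y. y \<in> T \<Longrightarrow> 0 \<le> w y" "sum w T = (1::real)"
  obtains \<nu> where "set_pmf \<nu> \<subseteq> T" "\<And>y. y \<in> T \<Longrightarrow> pmf \<nu> y = w y"
proof -
  define w' where "w' y = (if y \<in> T then w y else 0)" for y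
  have nonneg: "0 \<le> w' y" for y using assms(2) by (simp add: w'_def)
  have "(\<integral>\<^sup>+y. ennreal (w' y) \<partial>count_space UNIV) = (\<Sum>y\<in>T. ennreal (w' y))"
    using assms(1) by (intro nn_integral_count_space'[where A=T]) (auto simp: w'_def)
  also have "\<dots> = ennreal (\<Sum>y\<in>T. w' y)" using nonneg by (simp add: sum_ennreal)
  also have "(\<Sum>y\<in>T. w' y) = 1" using assms(3) by (simp add: w'_def)
  finally have one: "(\<integral>\<^sup>+y. ennreal (w' y) \<partial>count_space UNIV) = 1" by simp
  note emb = pmf_embed_pmf[OF nonneg one] set_embed_pmf[OF nonneg one]
  show ?thesis by (rule that[of "embed_pmf w'"]) (auto simp: emb w'_def split: if_splits)
qed

text \<open>If no \<open>x\<close> met the bound, compactness would give finitely many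
  \<open>y\<close> that jointly exceed \<open>v'\<close> everywhere, and separation would turn them
  into a prior against which every \<open>x\<close> pays at least \<open>v'\<close>. This
  contradicts the Bayesian bound \<open>v\<close>. Separation yields only a weak inequality, whence
  the gap between \<open>v\<close> and \<open>v'\<close>.\<close>

lemma compact_convexlike_minimax:
  fixes f :: "'x::topological_space \<Rightarrow> 'y \<Rightarrow> real"
  assumes compact: "compact X"
    and cont: "\<And>y. y \<in> Y \<Longrightarrow> continuous_on UNIV (\<lambda>x. f x y)"
    and convexlike: "\<And>x1 x2 t. x1 \<in> X \<Longrightarrow> x2 \<in> X \<Longrightarrow> 0 \<le> t \<Longrightarrow> t \<le> 1 \<Longrightarrow>
      \<exists>x\<in>X. \<forall>y\<in>Y. f x y \<le> (1 - t) * f x1 y + t * f x2 y"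
    and nonempty: "Y \<noteq> {}"
    and bayes: "\<And>\<nu>. finite (set_pmf \<nu>) \<Longrightarrow> set_pmf \<nu> \<subseteq> Y \<Longrightarrow>
      \<exists>x\<in>X. (\<Sum>y\<in>set_pmf \<nu>. pmf \<nu> y * f x y) \<le> v"
    and less: "v < v'"
  shows "\<exists>x\<in>X. \<forall>y\<in>Y. f x y \<le> v'"
proof (rule ccontr)
  assume "\<not> ?thesis"
  then have cover: "X \<subseteq> (\<Union>y\<in>Y. {x. v' < f x y})" by force
  have "open {x. v' < f x y}" if "y \<in> Y" for y
    using cont[OF that] by (intro open_Collect_less continuous_on_const)
  then obtain T where T: "T \<subseteq> Y" "finite T" "X \<subseteq> (\<Union>y\<in>T. {x. v' < f x y})"
    by (rule compactE_image[OF compact _ cover]) blast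
  obtain y1 where y1: "y1 \<in> Y" using nonempty by blast
  then have "X \<noteq> {}" using bayes[of "return_pmf y1"] by auto
  then have "T \<noteq> {}" using T(3) by auto
  have "\<exists>\<nu>. (\<forall>y\<in>T. 0 \<le> \<nu> y) \<and> sum \<nu> T = 1 \<and> (\<forall>x\<in>X. 0 \<le> (\<Sum>y\<in>T. \<nu> y * (f x y - v')))"
  proof (rule convexlike_finite[OF T(2) \<open>T \<noteq> {}\<close>])
    show "\<exists>y\<in>T. 0 \<le> f x y - v'" if x: "x \<in> X" for x
    proof -
      obtain y where "y \<in> T" "v' < f x y" using T(3) x by blast
      then show ?thesis by (intro bexI[of _ y]) auto
    qed
    fix x1 x2 and t :: real
    assume "x1 \<in> X" "x2 \<in> X" "0 \<le> t" "t \<le> 1"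
    then obtain x where "x \<in> X" "\<forall>y\<in>Y. f x y \<le> (1 - t) * f x1 y + t * f x2 y"
      using convexlike by blast
    then show "\<exists>x\<in>X. \<forall>y\<in>T. f x y - v' \<le> (1 - t) * (f x1 y - v') + t * (f x2 y - v')"
      using T(1) by (intro bexI[of _ x]) (auto simp: algebra_simps)
  qed
  then obtain w where w: "\<And>y. y \<in> T \<Longrightarrow> 0 \<le> w y" "sum w T = 1"
    "\<And>x. x \<in> X \<Longrightarrow> 0 \<le> (\<Sum>y\<in>T. w y * (f x y - v'))" by blast
  obtain \<nu> where \<nu>: "set_pmf \<nu> \<subseteq> T" "\<And>y. y \<in> T \<Longrightarrow> pmf \<nu> y = w y"
    using pmf_of_weights[of T w] T(2) w(1,2) by metis
  obtain x where x: "x \<in> X" "(\<Sum>y\<in>set_pmf \<nu>. pmf \<nu> y * f x y) \<le> v"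
    using bayes[of \<nu>] \<nu>(1) T(1,2) finite_subset by (metis subset_trans)
  have "(\<Sum>y\<in>set_pmf \<nu>. pmf \<nu> y * f x y) = (\<Sum>y\<in>T. pmf \<nu> y * f x y)"
    using \<nu>(1) T(2) by (intro sum.mono_neutral_left) (auto simp: set_pmf_iff)
  also have "\<dots> = (\<Sum>y\<in>T. w y * f x y)" using \<nu>(2) by (intro sum.cong) auto
  also have "\<dots> = (\<Sum>y\<in>T. w y * (f x y - v')) + v' * sum w T"
    by (simp add: right_diff_distrib sum_subtractf sum_distrib_left mult.commute)
  finally show False using w(2) w(3)[OF x(1)] x(2) less by simp
qed

text \<open>Tychonoff's theorem for functions. Strategies are functions on whole types, so the
  number of coordinates may be infinite.\<close>

lemma compact_PiE_UNIV:
  fixes K :: "'i \<Rightarrow> 'b::topological_space set"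
  assumes "\<And>i. compact (K i)"
  shows "compact {x. \<forall>i. x i \<in> K i}"
proof -
  have "compactin (product_topology (\<lambda>i::'i. euclidean :: 'b topology) UNIV) (PiE UNIV K)"
    using assms by (subst compactin_PiE) simp
  moreover have "PiE UNIV K = {x. \<forall>i. x i \<in> K i}" by auto
  ultimately show ?thesis by (simp add: euclidean_product_topology)
qed

section \<open>Conditional means of discrete laws\<close>

text \<open>An elementary conditional expectation of \<open>X\<close> given
  \<open>k = \<kappa>\<close>, written as a finite sum so that it can be rearranged directly. On a
  level of mass zero its value is 0.\<close>

definition cond_mean :: "'y pmf \<Rightarrow> ('y \<Rightarrow> 'k) \<Rightarrow> ('y \<Rightarrow> 'v::real_vector) \<Rightarrow> 'k \<Rightarrow> 'v" where
  "cond_mean \<nu> k X \<kappa> = (1 / (\<Sum>y | y \<in> set_pmf \<nu> \<and> k y = \<kappa>. pmf \<nu> y)) *\<^sub>R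
     (\<Sum>y | y \<in> set_pmf \<nu> \<and> k y = \<kappa>. pmf \<nu> y *\<^sub>R X y)"

lemma level_mass_pos:
  assumes "finite (set_pmf \<nu>)" "y \<in> set_pmf \<nu>"
  shows "0 < (\<Sum>y' | y' \<in> set_pmf \<nu> \<and> k y' = k y. pmf \<nu> y')"
  using assms by (intro sum_pos) (auto simp: pmf_positive)

text \<open>The tower property: on each level of \<open>k\<close> the factor \<open>H\<close> is
  constant and the centred variable has total weight zero.\<close>

lemma cond_mean_orthogonal:
  fixes X :: "'y \<Rightarrow> 'v::real_inner"
  assumes fin: "finite (set_pmf \<nu>)"
  shows "(\<Sum>y\<in>set_pmf \<nu>. pmf \<nu> y * (H (k y) \<bullet> (cond_mean \<nu> k X (k y) - X y))) = 0"
proof -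
  have "(\<Sum>y | y \<in> set_pmf \<nu> \<and> k y = \<kappa>. pmf \<nu> y * (H (k y) \<bullet> (cond_mean \<nu> k X (k y) - X y))) = 0"
    if "\<kappa> \<in> k ` set_pmf \<nu>" for \<kappa>
  proof -
    let ?L = "{y \<in> set_pmf \<nu>. k y = \<kappa>}"
    have "0 < sum (pmf \<nu>) ?L" using level_mass_pos[OF fin, of _ k] that by auto
    then have m: "sum (pmf \<nu>) ?L *\<^sub>R cond_mean \<nu> k X \<kappa> = (\<Sum>y\<in>?L. pmf \<nu> y *\<^sub>R X y)"
      by (simp add: cond_mean_def)
    have "(\<Sum>y\<in>?L. pmf \<nu> y * (H (k y) \<bullet> (cond_mean \<nu> k X (k y) - X y)))
        = (\<Sum>y\<in>?L. H \<kappa> \<bullet> (pmf \<nu> y *\<^sub>R cond_mean \<nu> k X \<kappa> - pmf \<nu> y *\<^sub>R X y))"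
      by (intro sum.cong) (auto simp: algebra_simps)
    also have "\<dots> = H \<kappa> \<bullet> (sum (pmf \<nu>) ?L *\<^sub>R cond_mean \<nu> k X \<kappa> - (\<Sum>y\<in>?L. pmf \<nu> y *\<^sub>R X y))"
      by (simp add: inner_sum_right[symmetric] sum_subtractf scaleR_left.sum)
    finally show ?thesis using m by simp
  qed
  then show ?thesis by (subst sum.image_gen[OF fin, of _ k]) (simp add: sum.neutral)
qed

lemma cond_mean_in_convex:
  assumes fin: "finite (set_pmf \<nu>)" and y: "y \<in> set_pmf \<nu>"
    and C: "convex C" "\<And>y. y \<in> set_pmf \<nu> \<Longrightarrow> X y \<in> C"
  shows "cond_mean \<nu> k X (k y) \<in> C"
proof -
  let ?L = "{y' \<in> set_pmf \<nu>. k y' = k y}"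
  have pos: "0 < sum (pmf \<nu>) ?L" using level_mass_pos[OF fin y] .
  have "(\<Sum>y'\<in>?L. (pmf \<nu> y' / sum (pmf \<nu>) ?L) *\<^sub>R X y') \<in> C"
    using fin C pos by (intro convex_sum) (auto simp: sum_divide_distrib[symmetric])
  then show ?thesis by (simp add: cond_mean_def scaleR_sum_right)
qed

text \<open>The action is independent of the pair drawn from the prior, so conditioning on signal
  and action selects a slice of mass \<open>?s * pmf p a\<close>, and the factor
  \<open>pmf p a\<close> cancels.\<close>

lemma cond_exp_pair_pmf:
  fixes X :: "'y \<Rightarrow> 'v::{banach, second_countable_topology}"
  assumes fin: "finite (set_pmf \<nu>)" and y: "y \<in> set_pmf \<nu>" and a: "a \<in> set_pmf p"
  shows "cond_exp_pmf (pair_pmf \<nu> p) (\<lambda>\<omega>. X (fst \<omega>)) (\<lambda>\<omega>. (k (snd \<omega>) (fst \<omega>), snd \<omega>)) (y, a)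
    = cond_mean \<nu> (k a) X (k a y)"
proof -
  let ?M = "pair_pmf \<nu> p"
  let ?L = "{y' \<in> set_pmf \<nu>. k a y' = k a y}"
  let ?B = "{\<omega>. (k (snd \<omega>) (fst \<omega>), snd \<omega>) = (k a y, a)}"
  let ?s = "sum (pmf \<nu>) ?L"
  have BL: "set_pmf ?M \<inter> ?B = (\<lambda>y. (y, a)) ` ?L" using a by auto
  have inj: "inj_on (\<lambda>y. (y, a)) ?L" by (auto intro: inj_onI)
  have ne: "set_pmf ?M \<inter> ?B \<noteq> {}" using BL y by auto
  have "measure ?M ?B = measure ?M (set_pmf ?M \<inter> ?B)"
    by (subst Int_commute) (rule measure_Int_set_pmf[symmetric])
  also have "\<dots> = sum (pmf ?M) ((\<lambda>y. (y, a)) ` ?L)"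
    unfolding BL using fin by (intro measure_measure_pmf_finite) auto
  also have "\<dots> = ?s * pmf p a"
    by (subst sum.reindex[OF inj]) (simp add: pmf_pair sum_distrib_right)
  finally have meas: "measure ?M ?B = ?s * pmf p a" .
  have pa: "0 < pmf p a" using a by (simp add: pmf_positive)
  have "cond_exp_pmf ?M (\<lambda>\<omega>. X (fst \<omega>)) (\<lambda>\<omega>. (k (snd \<omega>) (fst \<omega>), snd \<omega>)) (y, a)
      = measure_pmf.expectation (cond_pmf ?M ?B) (\<lambda>\<omega>. X (fst \<omega>))"
    by (simp add: cond_exp_pmf_def)
  also have "\<dots> = (\<Sum>\<omega>\<in>(\<lambda>y. (y, a)) ` ?L. pmf (cond_pmf ?M ?B) \<omega> *\<^sub>R X (fst \<omega>))"
  proof (rule integral_measure_pmf)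
    show "finite ((\<lambda>y. (y, a)) ` ?L)" using fin by simp
    show "\<omega> \<in> (\<lambda>y. (y, a)) ` ?L" if "\<omega> \<in> set_pmf (cond_pmf ?M ?B)" for \<omega>
      using that unfolding set_cond_pmf[OF ne] BL .
  qed
  also have "\<dots> = (\<Sum>y'\<in>?L. (1 / ?s) *\<^sub>R (pmf \<nu> y' *\<^sub>R X y'))"
    unfolding sum.reindex[OF inj]
  proof (intro sum.cong refl)
    fix y' assume "y' \<in> ?L"
    then have "pmf (cond_pmf ?M ?B) (y', a) = 1 / ?s * pmf \<nu> y'"
      unfolding pmf_cond[OF ne] meas pmf_pair using pa by simp
    then show "((\<lambda>\<omega>. pmf (cond_pmf ?M ?B) \<omega> *\<^sub>R X (fst \<omega>)) \<circ> (\<lambda>y. (y, a))) y'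
        = (1 / ?s) *\<^sub>R (pmf \<nu> y' *\<^sub>R X y')"
      by (simp only: o_def fst_conv scaleR_scaleR)
  qed
  also have "\<dots> = cond_mean \<nu> (k a) X (k a y)"
    by (simp add: cond_mean_def scaleR_sum_right)
  finally show ?thesis .
qed

section \<open>Strategies and payoffs\<close>

lemma inner_diff_convex_hull_le:
  fixes l :: "'v::real_inner"
  assumes A: "\<And>a. a \<in> A \<Longrightarrow> a \<bullet> l \<in> {0..1}" and "x \<in> convex hull A" "y \<in> convex hull A"
  shows "\<bar>(x - y) \<bullet> l\<bar> \<le> 1"
proof -
  have "{x. x \<bullet> l \<in> {0..1}} = {x. l \<bullet> x \<ge> 0} \<inter> {x. l \<bullet> x \<le> 1}" by (auto simp: inner_commute)
  then have "convex {x. x \<bullet> l \<in> {0..1}}"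
    by (simp add: convex_Int convex_halfspace_le convex_halfspace_ge)
  then have "convex hull A \<subseteq> {x. x \<bullet> l \<in> {0..1}}" using A by (intro hull_minimal) auto
  then have "x \<bullet> l \<in> {0..1}" "y \<bullet> l \<in> {0..1}" using assms(2,3) by blast+
  then show ?thesis by (auto simp: inner_diff_left)
qed

context linear_pm_game
begin

abbreviation Fr :: "real ^ 'd \<Rightarrow> real" where
  "Fr x \<equiv> real_of_ereal (F x)"

lemma F_proper: "proper_fun F" and F_convex: "convex_fun F"
  and F_smooth: "essentially_smooth F" and F_strict: "essentially_strictly_convex F"
  using legendre by (auto simp: legendre_def)

text \<open>An estimator is encoded by the dual points \<open>w = \<nabla>F(q) - \<eta> g(a, \<sigma>) / p(a)\<close>, paired with a
  number \<open>r\<close> above \<open>F\<^sup>\<star>(w)\<close>; carrying \<open>r\<close> makes the payoff continuous although \<open>F\<^sup>\<star>\<close> is only lower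
  semicontinuous. The norm bound makes the set compact.\<close>

definition epi :: "real \<Rightarrow> ((real ^ 'd) \<times> real) set" where
  "epi R = {v. norm v \<le> R \<and> (\<forall>x\<in>edom F. fst v \<bullet> x - Fr x \<le> snd v)}"

text \<open>The values of \<open>P\<close> off \<open>A\<close> are confined to the unit interval as
  well, which turns the first component into a closed subset of a product of compact
  intervals.\<close>

definition strategies :: "real \<Rightarrow>
    ((real ^ 'd \<Rightarrow> real) \<times> ((real ^ 'd) \<times> 's \<Rightarrow> (real ^ 'd) \<times> real)) set" where
  "strategies R = {(P, W). (\<forall>a. P a \<in> {0..1}) \<and> sum P A = 1 \<and> (\<forall>i. W i \<in> epi R)}"

text \<open>The contribution of one action per unit of probability, with \<open>y\<close> the pair
  of latent state and comparator and \<open>v\<close> the pair \<open>(w, r)\<close>. The bracket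
  merges the estimator term with the bound on \<open>Psi\<close>; the \<open>q \<bullet> w\<close>
  terms cancel, which leaves an expression affine in \<open>v\<close> and in the comparator.\<close>

definition cost :: "('z \<Rightarrow> real ^ 'd \<Rightarrow> real) \<Rightarrow> real \<Rightarrow> real \<Rightarrow> real ^ 'd \<Rightarrow> 'z \<times> (real ^ 'd) \<Rightarrow>
    real ^ 'd \<Rightarrow> (real ^ 'd) \<times> real \<Rightarrow> real" where
  "cost \<beta> c \<eta> q y a v = (a - snd y) \<bullet> loss (fst y) - c * \<beta> (fst y) a
     + 1 / \<eta> * (snd v - snd y \<bullet> fst v + Fr q + grad F q \<bullet> (snd y - q))"

definition payoff :: "('z \<Rightarrow> real ^ 'd \<Rightarrow> real) \<Rightarrow> real \<Rightarrow> real \<Rightarrow> real ^ 'd \<Rightarrow>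
    (real ^ 'd \<Rightarrow> real) \<times> ((real ^ 'd) \<times> 's \<Rightarrow> (real ^ 'd) \<times> real) \<Rightarrow> 'z \<times> (real ^ 'd) \<Rightarrow> real" where
  "payoff \<beta> c \<eta> q x y = (\<Sum>a\<in>A. fst x a * cost \<beta> c \<eta> q y a (snd x (a, \<Phi> a (fst y))))"

lemma strategiesD:
  assumes "(P, W) \<in> strategies R"
  shows "0 \<le> P a" "P a \<le> 1" "sum P A = 1" "W i \<in> epi R"
  using assms by (simp_all add: strategies_def del: split_paired_All)

section \<open>Compactness, continuity and convexity for the minimax theorem\<close>

lemma compact_epi: "compact (epi R)"
proof -
  have "epi R = cball 0 R \<inter> (\<Inter>x\<in>edom F. {v. fst v \<bullet> x - Fr x \<le> snd v})"
    by (auto simp: epi_def)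
  moreover have "closed {v::(real ^ 'd) \<times> real. fst v \<bullet> x - Fr x \<le> snd v}" for x
    by (intro closed_Collect_le continuous_intros)
  ultimately show ?thesis by (simp add: compact_Int_closed closed_INT)
qed

lemma convex_epi: "convex (epi R)"
proof -
  have "convex {v::(real ^ 'd) \<times> real. fst v \<bullet> x - Fr x \<le> snd v}" for x
  proof -
    have "{v::(real ^ 'd) \<times> real. fst v \<bullet> x - Fr x \<le> snd v} = {v. (x, -1) \<bullet> v \<le> Fr x}"
      by (auto simp: inner_prod_def inner_commute)
    then show ?thesis by (simp add: convex_halfspace_le)
  qed
  moreover have "epi R = cball 0 R \<inter> (\<Inter>x\<in>edom F. {v. fst v \<bullet> x - Fr x \<le> snd v})"
    by (auto simp: epi_def)
  ultimately show ?thesis by (simp add: convex_Int convex_INT)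
qed

lemma compact_strategies: "compact (strategies R)"
proof -
  have "compact {P::real ^ 'd \<Rightarrow> real. \<forall>a. P a \<in> {0..1}}"
    by (rule compact_PiE_UNIV) simp
  moreover have "closed {P::real ^ 'd \<Rightarrow> real. sum P A = 1}"
    by (intro closed_Collect_eq continuous_on_const continuous_on_sum) simp
  ultimately have "compact ({P::real ^ 'd \<Rightarrow> real. \<forall>a. P a \<in> {0..1}} \<inter> {P. sum P A = 1})"
    by (rule compact_Int_closed)
  moreover have "compact {W::(real ^ 'd) \<times> 's \<Rightarrow> (real ^ 'd) \<times> real. \<forall>i. W i \<in> epi R}"
    by (rule compact_PiE_UNIV) (rule compact_epi)
  ultimately have "compact (({P::real ^ 'd \<Rightarrow> real. \<forall>a. P a \<in> {0..1}} \<inter> {P. sum P A = 1}) \<times>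
      {W::(real ^ 'd) \<times> 's \<Rightarrow> (real ^ 'd) \<times> real. \<forall>i. W i \<in> epi R})"
    by (rule compact_Times)
  then show ?thesis by (rule back_subst) (auto simp: strategies_def)
qed

lemma continuous_payoff: "continuous_on UNIV (\<lambda>x. payoff \<beta> c \<eta> q x y)"
proof -
  have W: "continuous_on UNIV
      (\<lambda>x::(real ^ 'd \<Rightarrow> real) \<times> ((real ^ 'd) \<times> 's \<Rightarrow> (real ^ 'd) \<times> real). snd x i)" for i
    by (rule continuous_on_compose2[OF continuous_on_product_coordinates
          continuous_on_snd[OF continuous_on_id]]) auto
  have P: "continuous_on UNIV
      (\<lambda>x::(real ^ 'd \<Rightarrow> real) \<times> ((real ^ 'd) \<times> 's \<Rightarrow> (real ^ 'd) \<times> real). fst x a)" for a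
    by (rule continuous_on_compose2[OF continuous_on_product_coordinates
          continuous_on_fst[OF continuous_on_id]]) auto
  show ?thesis unfolding payoff_def cost_def by (intro continuous_intros W P)
qed

lemma cost_affine:
  "s + t = 1 \<Longrightarrow> cost \<beta> c \<eta> q y a (s *\<^sub>R v1 + t *\<^sub>R v2)
    = s * cost \<beta> c \<eta> q y a v1 + t * cost \<beta> c \<eta> q y a v2"
proof -
  assume "s + t = 1"
  then have s: "s = 1 - t" by simp
  show ?thesis
    unfolding s cost_def
    by (simp add: algebra_simps inner_simps add_divide_distrib diff_divide_distrib)
qed

text \<open>The perspective trick: averaging \<open>p(a)\<close> and \<open>p(a) w\<close> separately averages the payoff.\<close>

lemma strategies_convexlike:
  assumes x: "x1 \<in> strategies R" "x2 \<in> strategies R" and t: "0 \<le> t" "t \<le> 1"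
  shows "\<exists>x\<in>strategies R. \<forall>y. payoff \<beta> c \<eta> q x y
    = (1 - t) * payoff \<beta> c \<eta> q x1 y + t * payoff \<beta> c \<eta> q x2 y"
proof -
  obtain P1 W1 P2 W2 where eq: "x1 = (P1, W1)" "x2 = (P2, W2)" by fastforce
  note x1 = strategiesD[OF x(1)[unfolded eq]] and x2 = strategiesD[OF x(2)[unfolded eq]]
  note P = x1(1) x2(1) x1(2) x2(2)
  define P where "P a = (1 - t) * P1 a + t * P2 a" for a
  \<comment> \<open>The weights are the posterior shares of the two strategies given the action.
    Where the mixed probability vanishes, so do both contributions, and any element of
    \<open>epi R\<close> serves.\<close>
  define W where "W i = (if P (fst i) = 0 then W1 i else
    ((1 - t) * P1 (fst i) / P (fst i)) *\<^sub>R W1 i + (t * P2 (fst i) / P (fst i)) *\<^sub>R W2 i)" for i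
  have P0: "0 \<le> (1 - t) * P1 a" "0 \<le> t * P2 a" for a using P t by auto
  have frac: "(1 - t) * P1 a / P a + t * P2 a / P a = 1" if "P a \<noteq> 0" for a
    using that by (simp add: P_def add_divide_distrib[symmetric])
  have "W i \<in> epi R" for i
  proof (cases "P (fst i) = 0")
    case True
    then show ?thesis using x1(4) by (simp add: W_def)
  next
    case False
    moreover have "0 \<le> P (fst i)" using P0[of "fst i"] by (simp add: P_def)
    ultimately show ?thesis using x1(4)[of i] x2(4)[of i] frac[OF False] P0[of "fst i"]
      by (auto simp: W_def intro!: convexD[OF convex_epi])
  qed
  moreover have "P a \<in> {0..1}" for a
    using P0[of a] P t convex_bound_le[of "P1 a" 1 "P2 a" "1 - t" t] by (auto simp: P_def)
  moreover have "sum P A = 1"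
    using x1(3) x2(3) by (simp add: P_def sum.distrib sum_distrib_left[symmetric])
  ultimately have "(P, W) \<in> strategies R" by (simp add: strategies_def)
  moreover have "payoff \<beta> c \<eta> q (P, W) y
      = (1 - t) * payoff \<beta> c \<eta> q x1 y + t * payoff \<beta> c \<eta> q x2 y" for y
  proof -
    let ?c = "cost \<beta> c \<eta> q y"
    have "P a * ?c a (W (a, \<sigma>))
        = (1 - t) * (P1 a * ?c a (W1 (a, \<sigma>))) + t * (P2 a * ?c a (W2 (a, \<sigma>)))" for a \<sigma>
    proof (cases "P a = 0")
      case True
      then have "(1 - t) * P1 a = 0" "t * P2 a = 0" using P0[of a] unfolding P_def by linarith+
      then show ?thesis using True by auto
    next
      case False
      have "?c a (W (a, \<sigma>)) = (1 - t) * P1 a / P a * ?c a (W1 (a, \<sigma>))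
          + t * P2 a / P a * ?c a (W2 (a, \<sigma>))"
        unfolding W_def by (simp only: fst_conv False if_False cost_affine[OF frac[OF False]])
      then show ?thesis using False by (simp add: distrib_left)
    qed
    then show ?thesis
      by (simp only: payoff_def eq fst_conv snd_conv sum.distrib sum_distrib_left)
  qed
  ultimately show ?thesis by (intro bexI[of _ "(P, W)"] allI)
qed

text \<open>Together with a lower bound at \<open>q\<close>, this carries an upper bound from the
  shrunk domain back to \<open>D\<close>.\<close>

lemma payoff_shrink:
  "payoff \<beta> c \<eta> q x (z, (1 - \<epsilon>) *\<^sub>R a' + \<epsilon> *\<^sub>R q)
    = (1 - \<epsilon>) * payoff \<beta> c \<eta> q x (z, a') + \<epsilon> * payoff \<beta> c \<eta> q x (z, q)"
proof -
  have "cost \<beta> c \<eta> q (z, (1 - \<epsilon>) *\<^sub>R a' + \<epsilon> *\<^sub>R q) a v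
      = (1 - \<epsilon>) * cost \<beta> c \<eta> q (z, a') a v + \<epsilon> * cost \<beta> c \<eta> q (z, q) a v" for a v
    unfolding cost_def
    by (simp add: algebra_simps inner_simps add_divide_distrib diff_divide_distrib)
  then show ?thesis
    by (simp only: payoff_def fst_conv snd_conv distrib_left sum.distrib sum_distrib_left
        mult.left_commute[of "fst x _"])
qed

text \<open>At the comparator \<open>q\<close> the bracket reduces to
  \<open>r - q \<bullet> w + F q\<close>, which is nonnegative by the Fenchel-Young inequality. Only
  the loss and the penalty remain, and the bound is independent of \<open>R\<close>.\<close>

lemma payoff_at_q_ge:
  assumes x: "x \<in> strategies R" and z: "z \<in> Zs" and q: "q \<in> D" and c: "0 \<le> c" and eta: "0 < \<eta>"
    and B: "\<And>a. a \<in> A \<Longrightarrow> \<beta> z a \<le> B"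
  shows "- (1 + c * B) \<le> payoff \<beta> c \<eta> q x (z, q)"
proof -
  obtain P W where eq: "x = (P, W)" by fastforce
  note P = strategiesD(1,3)[OF x[unfolded eq]] and W = strategiesD(4)[OF x[unfolded eq]]
  have "- (1 + c * B) \<le> cost \<beta> c \<eta> q (z, q) a (W i)" if a: "a \<in> A" for a i
  proof -
    have "0 \<le> snd (W i) - q \<bullet> fst (W i) + Fr q"
      using q domain_dom W[of i] by (fastforce simp: epi_def inner_commute)
    then have "0 \<le> 1 / \<eta> * (snd (W i) - q \<bullet> fst (W i) + Fr q)"
      using eta by simp
    moreover have "\<bar>(a - q) \<bullet> loss z\<bar> \<le> 1"
      using inner_diff_convex_hull_le[of A "loss z" a q] inner_loss z a q domain_subset hull_subset
      by (meson hull_inc subsetD)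
    moreover have "c * \<beta> z a \<le> c * B" using B[OF a] c by (rule mult_left_mono)
    ultimately show ?thesis by (simp add: cost_def)
  qed
  then have "(\<Sum>a\<in>A. P a * - (1 + c * B)) \<le> payoff \<beta> c \<eta> q x (z, q)"
    unfolding payoff_def eq using P by (intro sum_mono) (auto intro!: mult_left_mono)
  then show ?thesis using P(2) by (simp only: sum_distrib_right[symmetric] mult_1)
qed

text \<open>This controls the price of mixing with the uniform distribution. The penalty enters with
  a negative sign, so the sign of \<open>\<beta>\<close> suffices for an upper bound.\<close>

lemma cost_bounded:
  assumes c: "0 \<le> c" and eta: "0 < \<eta>" and beta: "\<And>z a. z \<in> Zs \<Longrightarrow> a \<in> A \<Longrightarrow> 0 \<le> \<beta> z a"
  obtains C where "\<forall>z\<in>Zs. \<forall>a'\<in>D. \<forall>a\<in>A. \<forall>v\<in>epi R.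
    cost \<beta> c \<eta> q (z, a') a v \<le> C"
proof -
  obtain K where K: "\<And>x. x \<in> D \<Longrightarrow> norm x \<le> K"
    using compact_imp_bounded[OF compact_domain] by (auto simp: bounded_iff)
  let ?C = "R + K * R + \<bar>Fr q\<bar> + norm (grad F q) * (K + norm q)"
  have bound: "cost \<beta> c \<eta> q (z, a') a v \<le> 1 + 1 / \<eta> * ?C"
    if *: "z \<in> Zs" "a' \<in> D" "a \<in> A" "v \<in> epi R" for z a' a v
  proof -
    have v: "norm v \<le> R" using *(4) by (simp add: epi_def)
    have "\<bar>snd v\<bar> \<le> R" using norm_snd_le[of "snd v" "fst v"] v by simp
    moreover have "\<bar>a' \<bullet> fst v\<bar> \<le> K * R"
    proof -
      have "\<bar>a' \<bullet> fst v\<bar> \<le> norm a' * norm (fst v)" by (rule Cauchy_Schwarz_ineq2)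
      also have "\<dots> \<le> K * R"
        using K[OF *(2)] norm_fst_le[of "fst v" "snd v"] v
        by (intro mult_mono) (auto intro: order_trans[OF norm_ge_zero])
      finally show ?thesis .
    qed
    moreover have "\<bar>grad F q \<bullet> (a' - q)\<bar> \<le> norm (grad F q) * (K + norm q)"
    proof -
      have "\<bar>grad F q \<bullet> (a' - q)\<bar> \<le> norm (grad F q) * norm (a' - q)" by (rule Cauchy_Schwarz_ineq2)
      also have "\<dots> \<le> norm (grad F q) * (K + norm q)"
        using K[OF *(2)] norm_triangle_ineq4[of a' q] by (intro mult_left_mono) auto
      finally show ?thesis .
    qed
    ultimately have "snd v - a' \<bullet> fst v + Fr q + grad F q \<bullet> (a' - q) \<le> ?C" by linarith
    then have "1 / \<eta> * (snd v - a' \<bullet> fst v + Fr q + grad F q \<bullet> (a' - q)) \<le> 1 / \<eta> * ?C"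
      using eta by (intro mult_left_mono) auto
    moreover have "\<bar>(a - a') \<bullet> loss z\<bar> \<le> 1"
      using inner_diff_convex_hull_le[of A "loss z" a a'] inner_loss * domain_subset
      by (meson hull_inc subsetD)
    moreover have "0 \<le> c * \<beta> z a" using c beta[OF *(1,3)] by simp
    ultimately show ?thesis by (simp add: cost_def)
  qed
  show ?thesis by (rule that[of "1 + 1 / \<eta> * ?C"]) (intro ballI bound)
qed

text \<open>Decodes a strategy into an estimator. Positivity of \<open>P\<close> lets the scaling by
  \<open>\<eta> / pmf p a\<close> recover \<open>grad F q - w\<close> exactly; the inequality arises
  because \<open>r\<close> only dominates the conjugate at \<open>w\<close>.\<close>

lemma objective_le_payoff:
  assumes x: "(P, W) \<in> strategies R" and pos: "\<And>a. a \<in> A \<Longrightarrow> 0 < P a"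
    and p: "\<And>a. a \<in> A \<Longrightarrow> pmf p a = P a" and q: "q \<in> dom_grad F" and eta: "0 < \<eta>"
    and z: "z \<in> Zs"
    and g: "g = restrict (\<lambda>i. (P (fst i) / \<eta>) *\<^sub>R (grad F q - fst (W i))) (A \<times> S)"
  shows "objective A \<Phi> loss F q \<eta> z a' p g - ereal (c * (\<Sum>a\<in>A. pmf p a * \<beta> z a))
    \<le> ereal (payoff \<beta> c \<eta> q (P, W) (z, a'))"
proof -
  let ?u = "grad F q"
  define w where "w a = fst (W (a, \<Phi> a z))" for a
  define r where "r a = snd (W (a, \<Phi> a z))" for a
  have gv: "g (a, \<Phi> a z) = (P a / \<eta>) *\<^sub>R (?u - w a)" if "a \<in> A" for a
    using signal[OF that z] that by (simp add: g w_def)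
  have Psi: "Psi F q ((\<eta> / pmf p a) *\<^sub>R g (a, \<Phi> a z)) \<le> ereal (r a + Fr q - w a \<bullet> q)"
    if a: "a \<in> A" for a
  proof -
    have "(\<eta> / pmf p a) *\<^sub>R g (a, \<Phi> a z) = ?u - w a"
      using pos[OF a] eta by (simp add: gv[OF a] p[OF a])
    moreover have "w a \<bullet> x - Fr x \<le> r a" if "x \<in> edom F" for x
      using strategiesD(4)[OF x, of "(a, \<Phi> a z)"] that by (simp add: epi_def w_def r_def)
    ultimately show ?thesis
      using Psi_le[OF F_proper F_convex F_strict q, of "w a" "r a"] by simp
  qed
  have "ereal (1 / \<eta>) * (\<Sum>a\<in>A. ereal (pmf p a) * Psi F q ((\<eta> / pmf p a) *\<^sub>R g (a, \<Phi> a z)))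
      \<le> ereal (1 / \<eta>) * (\<Sum>a\<in>A. ereal (pmf p a) * ereal (r a + Fr q - w a \<bullet> q))"
    using eta Psi by (intro ereal_mult_left_mono sum_mono) auto
  also have "\<dots> = ereal (\<Sum>a\<in>A. P a * (1 / \<eta> * (r a + Fr q - w a \<bullet> q)))"
    by (simp add: sum_distrib_left p cong: sum.cong)
  finally have "objective A \<Phi> loss F q \<eta> z a' p g
      \<le> ereal ((\<Sum>a\<in>A. pmf p a * ((a - a') \<bullet> loss z)) + (a' - q) \<bullet> (\<Sum>a\<in>A. g (a, \<Phi> a z))
        + (\<Sum>a\<in>A. P a * (1 / \<eta> * (r a + Fr q - w a \<bullet> q))))"
    unfolding objective_def
    by (simp only: plus_ereal.simps(1)[symmetric]) (intro add_mono order_refl)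
  then have "objective A \<Phi> loss F q \<eta> z a' p g - ereal (c * (\<Sum>a\<in>A. pmf p a * \<beta> z a))
      \<le> ereal ((\<Sum>a\<in>A. pmf p a * ((a - a') \<bullet> loss z)) + (a' - q) \<bullet> (\<Sum>a\<in>A. g (a, \<Phi> a z))
        + (\<Sum>a\<in>A. P a * (1 / \<eta> * (r a + Fr q - w a \<bullet> q)))) - ereal (c * (\<Sum>a\<in>A. pmf p a * \<beta> z a))"
    by (intro ereal_minus_mono order_refl)
  also have "\<dots> = ereal (\<Sum>a\<in>A. P a * ((a - a') \<bullet> loss z) + (a' - q) \<bullet> g (a, \<Phi> a z)
        + P a * (1 / \<eta> * (r a + Fr q - w a \<bullet> q)) - P a * (c * \<beta> z a))"
    by (simp add: sum.distrib sum_subtractf inner_sum_right sum_distrib_left p mult.left_commute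
        cong: sum.cong)
  also have "\<dots> = ereal (payoff \<beta> c \<eta> q (P, W) (z, a'))"
    unfolding payoff_def cost_def
    using eta by (intro arg_cong[where f=ereal] sum.cong refl)
      (simp add: gv w_def[symmetric] r_def[symmetric] field_simps inner_simps inner_commute)
  finally show ?thesis .
qed

end

section \<open>Bayesian strategies and the minimax bound\<close>

lemma Youngs_inequality_rate:
  fixes b d :: real
  assumes lam: "1 < lam" and eta: "0 < \<eta>" and "0 \<le> b" "0 \<le> d"
  shows "b powr (1 - 1 / lam) * d powr (1 / lam)
    \<le> (1 - 1 / lam) * (\<eta> / lam) powr (1 / (lam - 1)) * b + d / \<eta>"
proof (cases "b = 0 \<or> d = 0")
  case True
  then show ?thesis using assms by auto
next
  case False
  then have bd: "0 < b" "0 < d" using assms by auto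
  \<comment> \<open>Young's inequality is applied to \<open>b * s\<close> and
    \<open>d * (lam / \<eta>)\<close>. The second scaling produces the term
    \<open>d / \<eta>\<close>, and \<open>s\<close> is then determined by the condition that the two
    scalings leave the product of powers unchanged.\<close>
  define s where "s = (\<eta> / lam) powr (1 / (lam - 1))"
  have s: "0 < s" using lam eta by (simp add: s_def)
  have "1 / (lam - 1) * (1 - 1 / lam) = 1 / lam" using lam by (simp add: field_simps)
  then have "s powr (1 - 1 / lam) = (\<eta> / lam) powr (1 / lam)"
    by (simp add: s_def powr_powr)
  then have "s powr (1 - 1 / lam) * (lam / \<eta>) powr (1 / lam) = 1"
    using lam eta by (simp add: powr_mult[symmetric])
  moreover have "(b * s) powr (1 - 1 / lam) * (d * (lam / \<eta>)) powr (1 / lam)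
      = b powr (1 - 1 / lam) * d powr (1 / lam) * (s powr (1 - 1 / lam) * (lam / \<eta>) powr (1 / lam))"
    using bd s lam eta by (simp add: powr_mult[of b] powr_mult[of d] del: times_divide_eq_right)
  ultimately have "b powr (1 - 1 / lam) * d powr (1 / lam)
      = (b * s) powr (1 - 1 / lam) * (d * (lam / \<eta>)) powr (1 / lam)"
    by simp
  also have "\<dots> \<le> (1 - 1 / lam) * (b * s) + 1 / lam * (d * (lam / \<eta>))"
    using lam eta bd s by (intro Youngs_inequality_0) auto
  finally show ?thesis using lam by (simp add: s_def mult.commute mult.left_commute)
qed

context linear_pm_game
begin

text \<open>The heart of the argument: against a prior \<open>\<nu>\<close> play the distribution granted by the information
  ratio and the gradient of \<open>F\<close> at the posterior mean of \<open>A\<^sup>*\<close>. Since \<open>\<nu>\<close> lives where \<open>F\<close> is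
  differentiable, no one-sided derivative enters the Bregman divergences.\<close>

lemma bayes_strategy:
  assumes lam: "1 < lam" and eta: "0 < \<eta>"
    and ratio: "adaptive_information_ratio A Zs \<Phi> loss D F \<alpha> \<beta> lam"
    and beta: "\<And>z a. z \<in> Zs \<Longrightarrow> a \<in> A \<Longrightarrow> 0 \<le> \<beta> z a"
    and c: "c = (1 - 1 / lam) * (\<eta> / lam) powr (1 / (lam - 1))"
    and C: "convex C" "C \<subseteq> D" "C \<subseteq> dom_grad F" "q \<in> C"
    and R: "\<And>x. x \<in> C \<Longrightarrow> norm (grad F x, grad F x \<bullet> x - Fr x) \<le> R"
    and \<nu>: "finite (set_pmf \<nu>)" "set_pmf \<nu> \<subseteq> Zs \<times> C"
  shows "\<exists>x\<in>strategies R. (\<Sum>y\<in>set_pmf \<nu>. pmf \<nu> y * payoff \<beta> c \<eta> q x y) \<le> \<alpha>"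
proof -
  let ?N = "set_pmf \<nu>"
  have "\<nu> \<in> finite_priors Zs D" using \<nu> C(2) by (auto simp: finite_priors_def)
  from ratio[unfolded adaptive_information_ratio_def Let_def case_prod_unfold, rule_format, OF this]
  obtain p where p: "set_pmf p \<subseteq> A" and
    ratio_p: "ereal (measure_pmf.expectation (pair_pmf \<nu> p) (\<lambda>\<omega>. (snd \<omega> - snd (fst \<omega>)) \<bullet> loss (fst (fst \<omega>))))
      \<le> ereal \<alpha>
        + ereal (measure_pmf.expectation (pair_pmf \<nu> p) (\<lambda>\<omega>. \<beta> (fst (fst \<omega>)) (snd \<omega>)) powr (1 - 1 / lam))
          * epowr (ereal_expectation (pair_pmf \<nu> p) (\<lambda>\<omega>.
                bregman F (cond_exp_pmf (pair_pmf \<nu> p) (\<lambda>\<omega>. snd (fst \<omega>))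
                    (\<lambda>\<omega>. (\<Phi> (snd \<omega>) (fst (fst \<omega>)), snd \<omega>)) \<omega>)
                  (measure_pmf.expectation (pair_pmf \<nu> p) (\<lambda>\<omega>. snd (fst \<omega>))))) (1 / lam)"
    by (auto simp: distributions_def)
  let ?M = "pair_pmf \<nu> p"
  define k where "k a y = \<Phi> a (fst y)" for a and y :: "'z \<times> (real ^ 'd)"
  define m where "m a \<sigma> = cond_mean \<nu> (k a) snd \<sigma>" for a \<sigma>
  define xb where "xb = (\<Sum>y\<in>?N. pmf \<nu> y *\<^sub>R snd y)"
  \<comment> \<open>Expectation under the law of the prior and an independent action, as a double
    sum over all of \<open>A\<close>; actions outside the support have weight zero.\<close>
  define E where "E f = (\<Sum>y\<in>?N. \<Sum>a\<in>A. pmf \<nu> y * pmf p a * f a y)"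
    for f :: "real ^ 'd \<Rightarrow> 'z \<times> (real ^ 'd) \<Rightarrow> real"
  have finA: "finite A" by (rule finite_actions)
  have sum_p: "sum (pmf p) A = 1" using p finA by (rule sum_pmf_eq_1[rotated])
  have sum_\<nu>: "sum (pmf \<nu>) ?N = 1" using \<nu>(1) by (intro sum_pmf_eq_1) auto
  have E_add: "E (\<lambda>a y. f a y + g a y) = E f + E g" for f g
    by (simp add: E_def distrib_left sum.distrib)
  have E_diff: "E (\<lambda>a y. f a y - g a y) = E f - E g" for f g
    by (simp add: E_def right_diff_distrib sum_subtractf)
  have E_cmult: "E (\<lambda>a y. t * f a y) = t * E f" for t f
    by (simp add: E_def sum_distrib_left mult.left_commute)
  have E_fst: "E (\<lambda>a. f) = (\<Sum>y\<in>?N. pmf \<nu> y * f y)" for f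
    using sum_p by (simp add: E_def mult.assoc sum_distrib_left[symmetric] sum_distrib_right[symmetric])
  have E_const: "E (\<lambda>a y. t) = t" for t
    using sum_\<nu> by (simp add: E_fst sum_distrib_right[symmetric])
  have E_mono: "E f \<le> E g" if "\<And>a y. a \<in> A \<Longrightarrow> y \<in> ?N \<Longrightarrow> f a y \<le> g a y" for f g
    unfolding E_def using that by (intro sum_mono mult_left_mono) auto
  have pmf_M: "pmf ?M \<omega> = pmf \<nu> (fst \<omega>) * pmf p (snd \<omega>)" for \<omega>
    by (cases \<omega>) (simp add: pmf_pair)
  have E_expectation: "measure_pmf.expectation ?M f = E (\<lambda>a y. f (y, a))"
    for f :: "('z \<times> (real ^ 'd)) \<times> (real ^ 'd) \<Rightarrow> real"
  proof -
    have "measure_pmf.expectation ?M f = (\<Sum>\<omega>\<in>?N \<times> A. pmf ?M \<omega> *\<^sub>R f \<omega>)"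
      using p \<nu>(1) finA by (intro integral_measure_pmf) auto
    then show ?thesis by (simp add: E_def sum.cartesian_product pmf_M case_prod_unfold)
  qed
  have E_inner: "E (\<lambda>a y. v \<bullet> (snd y - w)) = v \<bullet> (xb - w)" for v w
    using sum_\<nu> by (simp add: E_fst xb_def inner_diff_right right_diff_distrib sum_subtractf
        inner_sum_right sum_distrib_right[symmetric])
  have tower: "E (\<lambda>a y. H a (k a y) \<bullet> (m a (k a y) - snd y)) = 0" for H
    unfolding E_def m_def
    by (subst sum.swap)
      (simp add: mult.left_commute[of "pmf \<nu> _"] mult.assoc sum_distrib_left[symmetric]
        cond_mean_orthogonal[OF \<nu>(1)])
  have mC: "m a (k a y) \<in> C" if "y \<in> ?N" for a y
    unfolding m_def using \<nu>(2) C(1) by (intro cond_mean_in_convex[OF \<nu>(1) that]) auto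
  have xbC: "xb \<in> C"
    unfolding xb_def using \<nu> C(1) sum_\<nu> by (intro convex_sum) auto
  have dg: "has_gradient F x (grad F x)" "x \<in> edom F" if "x \<in> C" for x
    using that C(3) has_gradient_grad dom_grad_edom[OF F_proper F_convex] by blast+
  have tangent: "Fr x + grad F x \<bullet> (y - x) \<le> Fr y" if "x \<in> C" "y \<in> edom F" for x y
    using gradient_inequality[OF F_proper F_convex dg(1)[OF that(1)] that(2)] .

  \<comment> \<open>The expected divergence of the posterior mean from the prior mean. By the tower
    property its linear part averages to zero.\<close>
  define d where "d = E (\<lambda>a y. Fr (m a (k a y)) - Fr xb - grad F xb \<bullet> (m a (k a y) - xb))"
  have d_eq: "d = E (\<lambda>a y. Fr (m a (k a y))) - Fr xb"
  proof -
    have "E (\<lambda>a y. grad F xb \<bullet> (m a (k a y) - xb))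
        = E (\<lambda>a y. grad F xb \<bullet> (m a (k a y) - snd y) + grad F xb \<bullet> (snd y - xb))"
      by (simp add: inner_diff_right)
    also have "\<dots> = 0"
      using tower[of "\<lambda>_ _. grad F xb"] by (simp add: E_add E_inner)
    finally show ?thesis by (simp add: d_def E_diff E_const)
  qed
  have d_nonneg: "0 \<le> d"
  proof -
    have "E (\<lambda>a y. 0) \<le> d"
      unfolding d_def using tangent[OF xbC dg(2)[OF mC]] by (intro E_mono) (simp add: algebra_simps)
    then show ?thesis by (simp add: E_const)
  qed
  have mean: "measure_pmf.expectation ?M (\<lambda>\<omega>. snd (fst \<omega>)) = xb"
  proof -
    have "measure_pmf.expectation ?M (\<lambda>\<omega>. snd (fst \<omega>)) = (\<Sum>\<omega>\<in>?N \<times> A. pmf ?M \<omega> *\<^sub>R snd (fst \<omega>))"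
      using p \<nu>(1) finA by (intro integral_measure_pmf) auto
    also have "\<dots> = (\<Sum>y\<in>?N. \<Sum>a\<in>A. pmf p a *\<^sub>R (pmf \<nu> y *\<^sub>R snd y))"
      by (simp add: sum.cartesian_product pmf_M case_prod_unfold mult.commute)
    finally show ?thesis using sum_p by (simp only: xb_def scaleR_left.sum[symmetric] scaleR_one)
  qed
  have breg: "ereal_expectation ?M (\<lambda>\<omega>.
      bregman F (cond_exp_pmf ?M (\<lambda>\<omega>. snd (fst \<omega>)) (\<lambda>\<omega>. (\<Phi> (snd \<omega>) (fst (fst \<omega>)), snd \<omega>)) \<omega>)
        (measure_pmf.expectation ?M (\<lambda>\<omega>. snd (fst \<omega>)))) = ereal d"
  proof -
    let ?b = "\<lambda>a y. Fr (m a (k a y)) - Fr xb - grad F xb \<bullet> (m a (k a y) - xb)"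
    have "bregman F (cond_exp_pmf ?M (\<lambda>\<omega>. snd (fst \<omega>)) (\<lambda>\<omega>. (\<Phi> (snd \<omega>) (fst (fst \<omega>)), snd \<omega>)) (y, a)) xb
        = ereal (?b a y)" if ya: "y \<in> ?N" "a \<in> set_pmf p" for y a
    proof -
      have "cond_exp_pmf ?M (\<lambda>\<omega>. snd (fst \<omega>)) (\<lambda>\<omega>. (\<Phi> (snd \<omega>) (fst (fst \<omega>)), snd \<omega>)) (y, a)
          = m a (k a y)"
        using cond_exp_pair_pmf[OF \<nu>(1) ya, of snd k] by (simp add: k_def m_def)
      moreover obtain s where "F (m a (k a y)) = ereal s"
        using edom_real[OF F_proper F_convex dg(2)[OF mC[OF ya(1)]]] by blast
      moreover obtain t where "F xb = ereal t"
        using edom_real[OF F_proper F_convex dg(2)[OF xbC]] by blast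
      moreover have "xb \<in> dom_grad F" using xbC C(3) by blast
      ultimately show ?thesis by (simp add: bregman_def)
    qed
    then have *: "bregman F (cond_exp_pmf ?M (\<lambda>\<omega>. snd (fst \<omega>)) (\<lambda>\<omega>. (\<Phi> (snd \<omega>) (fst (fst \<omega>)), snd \<omega>)) \<omega>) xb
        = ereal (?b (snd \<omega>) (fst \<omega>))" if "\<omega> \<in> ?N \<times> set_pmf p" for \<omega>
      using that by (cases \<omega>) (simp only: mem_Sigma_iff fst_conv snd_conv)
    have "ereal_expectation ?M (\<lambda>\<omega>.
      bregman F (cond_exp_pmf ?M (\<lambda>\<omega>. snd (fst \<omega>)) (\<lambda>\<omega>. (\<Phi> (snd \<omega>) (fst (fst \<omega>)), snd \<omega>)) \<omega>)
        (measure_pmf.expectation ?M (\<lambda>\<omega>. snd (fst \<omega>))))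
      = (\<Sum>\<omega>\<in>?N \<times> set_pmf p. ereal (pmf ?M \<omega> * ?b (snd \<omega>) (fst \<omega>)))"
      unfolding ereal_expectation_def mean set_pair_pmf
      by (intro sum.cong refl) (simp only: * times_ereal.simps)
    also have "\<dots> = ereal (\<Sum>\<omega>\<in>?N \<times> A. pmf ?M \<omega> * ?b (snd \<omega>) (fst \<omega>))"
      using p \<nu>(1) finA
      by (subst sum_ereal) (intro arg_cong[where f=ereal] sum.mono_neutral_left,
          auto simp: pmf_M set_pmf_iff)
    also have "\<dots> = ereal d"
      by (simp add: d_def E_def sum.cartesian_product pmf_M case_prod_unfold)
    finally show ?thesis .
  qed
  define b where "b = E (\<lambda>a y. \<beta> (fst y) a)"
  define l where "l = E (\<lambda>a y. (a - snd y) \<bullet> loss (fst y))"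
  have b_nonneg: "0 \<le> b"
    unfolding b_def E_def using beta \<nu>(2) by (intro sum_nonneg mult_nonneg_nonneg) auto
  have "l \<le> \<alpha> + b powr (1 - 1 / lam) * d powr (1 / lam)"
    using ratio_p unfolding breg by (simp add: E_expectation b_def l_def epowr_def)
  also have "b powr (1 - 1 / lam) * d powr (1 / lam) \<le> c * b + d / \<eta>"
    unfolding c by (rule Youngs_inequality_rate[OF lam eta b_nonneg d_nonneg])
  finally have main: "l \<le> \<alpha> + (c * b + d / \<eta>)" by simp

  \<comment> \<open>The default \<open>q\<close> keeps \<open>X\<close> inside \<open>C\<close>: on signals of probability zero \<^const>\<open>cond_mean\<close> is \<open>0\<close>.\<close>
  define X where "X i = (if snd i \<in> k (fst i) ` ?N then m (fst i) (snd i) else q)"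
    for i :: "(real ^ 'd) \<times> 's"
  \<comment> \<open>The second component equals the conjugate at \<open>grad F (X i)\<close>, by
    equality in the Fenchel-Young inequality.\<close>
  define W where "W i = (grad F (X i), grad F (X i) \<bullet> X i - Fr (X i))" for i
  have XC: "X i \<in> C" for i using mC C(4) by (auto simp: X_def)
  have W: "W i \<in> epi R" for i
    using R[OF XC] tangent[OF XC] by (auto simp: epi_def W_def inner_diff_right algebra_simps)
  have "(pmf p, W) \<in> strategies R"
    using W sum_p by (simp add: strategies_def pmf_le_1 del: split_paired_All)
  moreover have "(\<Sum>y\<in>?N. pmf \<nu> y * payoff \<beta> c \<eta> q (pmf p, W) y) \<le> \<alpha>"
  proof -
    have "(\<Sum>y\<in>?N. pmf \<nu> y * payoff \<beta> c \<eta> q (pmf p, W) y) = E (\<lambda>a y. cost \<beta> c \<eta> q y a (W (a, k a y)))"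
      by (simp add: payoff_def E_def k_def sum_distrib_left mult.assoc)
    also have "\<dots> = E (\<lambda>a y. (a - snd y) \<bullet> loss (fst y) - c * \<beta> (fst y) a
        + 1 / \<eta> * (grad F (m a (k a y)) \<bullet> (m a (k a y) - snd y) - Fr (m a (k a y))
          + Fr q + grad F q \<bullet> (snd y - q)))"
      unfolding E_def
      by (intro sum.cong refl) (simp add: cost_def W_def X_def inner_diff_right inner_commute algebra_simps)
    \<comment> \<open>Given action and signal, \<open>grad F (m a \<sigma>)\<close> is fixed, so its
      inner product with the centred comparator has mean zero.\<close>
    also have "\<dots> = l - c * b + 1 / \<eta> * (- E (\<lambda>a y. Fr (m a (k a y))) + Fr q + grad F q \<bullet> (xb - q))"
      using tower[of "\<lambda>a \<sigma>. grad F (m a \<sigma>)"]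
      by (simp only: E_add E_diff E_cmult E_const E_inner l_def b_def) simp
    \<comment> \<open>The tangent at \<open>q\<close> lies below \<open>F\<close> at the prior mean
      \<open>xb\<close>; replacing it by \<open>F xb\<close> leaves exactly
      \<open>- d\<close>.\<close>
    also have "\<dots> \<le> l - c * b + 1 / \<eta> * (- d)"
      using tangent[OF C(4) dg(2)[OF xbC]] eta
      by (intro add_left_mono mult_left_mono) (auto simp: d_eq)
    finally show ?thesis using main by simp
  qed
  ultimately show ?thesis by (rule bexI[rotated])
qed

text \<open>A prior on the shrunk domain is also a prior on \<open>D\<close>, so the information
  ratio supplies the Bayesian hypothesis of the minimax theorem. The slack \<open>\<kappa>\<close>
  is the gap which that theorem asks for.\<close>

lemma strategy_minimax:
  assumes lam: "1 < lam" and eta: "0 < \<eta>"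
    and ratio: "adaptive_information_ratio A Zs \<Phi> loss D F \<alpha> \<beta> lam"
    and beta: "\<And>z a. z \<in> Zs \<Longrightarrow> a \<in> A \<Longrightarrow> 0 \<le> \<beta> z a"
    and c: "c = (1 - 1 / lam) * (\<eta> / lam) powr (1 / (lam - 1))"
    and q: "q \<in> D" "q \<in> dom_grad F" and \<epsilon>: "0 < \<epsilon>" "\<epsilon> < 1" and \<kappa>: "0 < \<kappa>" and Zs: "Zs \<noteq> {}"
  obtains x R where "x \<in> strategies R"
    "\<forall>z\<in>Zs. \<forall>a'\<in>D.
      payoff \<beta> c \<eta> q x (z, (1 - \<epsilon>) *\<^sub>R a' + \<epsilon> *\<^sub>R q) \<le> \<alpha> + \<kappa>"
proof -
  let ?C = "(\<lambda>d. (1 - \<epsilon>) *\<^sub>R d + \<epsilon> *\<^sub>R q) ` D"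
  \<comment> \<open>Comparing with \<open>q\<close> turns the finite diameter into an upper bound
    for \<open>F\<close> on \<open>D\<close>.\<close>
  define M where "M = (SUP (x, y)\<in>D \<times> D. F x - F y)"
  obtain s where Fq: "F q = ereal s"
    using edom_real[OF F_proper F_convex] q(1) domain_dom by blast
  have Fr_le: "F x - F q \<le> M" if "x \<in> D" for x
    unfolding M_def using that q(1) by (intro SUP_upper2[of "(x, q)"]) auto
  have "M \<noteq> -\<infinity>" using Fr_le[OF q(1)] by (auto simp: Fq)
  then obtain M' where M': "M = ereal M'" using diam_finite unfolding M_def[symmetric]
    by (cases M) auto
  have bound: "Fr x \<le> M' + Fr q" if x: "x \<in> D" for x
  proof -
    obtain t where "F x = ereal t" using edom_real[OF F_proper F_convex] x domain_dom by blast
    then show ?thesis using Fr_le[OF x] by (simp add: M' Fq)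
  qed
  obtain R where R: "\<And>d. d \<in> D \<Longrightarrow> (1 - \<epsilon>) *\<^sub>R d + \<epsilon> *\<^sub>R q \<in> dom_grad F"
    "\<And>d x. d \<in> D \<Longrightarrow> x = (1 - \<epsilon>) *\<^sub>R d + \<epsilon> *\<^sub>R q \<Longrightarrow>
      norm (grad F x, grad F x \<bullet> x - Fr x) \<le> R"
    using grad_bounded_on_shrunk[OF F_proper F_convex F_smooth
        compact_imp_bounded[OF compact_domain] domain_dom bound q \<epsilon>(1) less_imp_le[OF \<epsilon>(2)]]
    by metis
  have C: "convex ?C"
  proof -
    have "?C = (\<lambda>x. \<epsilon> *\<^sub>R q + x) ` (\<lambda>x. (1 - \<epsilon>) *\<^sub>R x) ` D" by (auto simp: image_image add.commute)
    then show ?thesis using convex_domain by (simp add: convex_scaling convex_translation)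
  qed
  have CD: "?C \<subseteq> D" using convexD_alt[OF convex_domain _ q(1), of _ \<epsilon>] \<epsilon> by auto
  have "q = (1 - \<epsilon>) *\<^sub>R q + \<epsilon> *\<^sub>R q" by (simp add: scaleR_left_distrib[symmetric])
  then have qC: "q \<in> ?C" by (rule image_eqI[where x=q]) (rule q(1))
  have "\<exists>x\<in>strategies R. \<forall>y\<in>Zs \<times> ?C. payoff \<beta> c \<eta> q x y \<le> \<alpha> + \<kappa>"
  proof (rule compact_convexlike_minimax[OF compact_strategies continuous_payoff])
    show "\<exists>x\<in>strategies R. \<forall>y\<in>Zs \<times> ?C. payoff \<beta> c \<eta> q x y
        \<le> (1 - t) * payoff \<beta> c \<eta> q x1 y + t * payoff \<beta> c \<eta> q x2 y"
      if t: "x1 \<in> strategies R" "x2 \<in> strategies R" "0 \<le> t" "t \<le> 1" for x1 x2 t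
    proof -
      obtain x where "x \<in> strategies R" "\<forall>y. payoff \<beta> c \<eta> q x y
          = (1 - t) * payoff \<beta> c \<eta> q x1 y + t * payoff \<beta> c \<eta> q x2 y"
        using strategies_convexlike[OF t, of \<beta> c \<eta> q] by blast
      then show ?thesis by (intro bexI[of _ x]) simp_all
    qed
    show "\<exists>x\<in>strategies R. (\<Sum>y\<in>set_pmf \<nu>. pmf \<nu> y * payoff \<beta> c \<eta> q x y) \<le> \<alpha>"
      if "finite (set_pmf \<nu>)" "set_pmf \<nu> \<subseteq> Zs \<times> ?C" for \<nu>
      using R qC CD by (intro bayes_strategy[OF lam eta ratio beta c C _ _ _ _ that]) auto
  qed (use Zs q(1) \<kappa> in auto)
  then show ?thesis using that by blast
qed

text \<open>The slack is spent in three portions: \<open>\<kappa> / 4\<close> on the minimax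
  theorem, \<open>\<kappa> / 4\<close> on undoing the shrinking, and \<open>\<kappa> / 2\<close> on
  making all probabilities positive.\<close>

lemma positive_strategy:
  assumes lam: "1 < lam" and eta: "0 < \<eta>"
    and ratio: "adaptive_information_ratio A Zs \<Phi> loss D F \<alpha> \<beta> lam"
    and beta: "\<And>z a. z \<in> Zs \<Longrightarrow> a \<in> A \<Longrightarrow> 0 \<le> \<beta> z a"
    and B: "\<And>z a. z \<in> Zs \<Longrightarrow> a \<in> A \<Longrightarrow> \<beta> z a \<le> B"
    and c: "c = (1 - 1 / lam) * (\<eta> / lam) powr (1 / (lam - 1))"
    and q: "q \<in> D" "q \<in> dom_grad F" and \<kappa>: "0 < \<kappa>" and Zs: "Zs \<noteq> {}"
  obtains P W R where "(P, W) \<in> strategies R" "\<forall>a\<in>A. 0 < P a"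
    "\<forall>z\<in>Zs. \<forall>a'\<in>D. payoff \<beta> c \<eta> q (P, W) (z, a') \<le> \<alpha> + \<kappa>"
proof -
  have c0: "0 \<le> c" unfolding c using lam by simp
  \<comment> \<open>The quotient is the bound obtained by solving the affine identity for the payoff
    at an unshrunk comparator. Here \<open>\<epsilon>\<close> must be fixed before the strategy,
    since \<open>R\<close> depends on it; the lower bound at \<open>q\<close> depends only on
    \<open>c\<close> and \<open>B\<close>.\<close>
  have "((\<lambda>\<epsilon>. (\<alpha> + \<kappa> / 4 + \<epsilon> * (1 + c * B)) / (1 - \<epsilon>)) \<longlongrightarrow> (\<alpha> + \<kappa> / 4 + 0 * (1 + c * B)) / (1 - 0)) (at_right 0)"
    by (intro tendsto_intros) auto
  then have "\<forall>\<^sub>F \<epsilon> in at_right 0. (\<alpha> + \<kappa> / 4 + \<epsilon> * (1 + c * B)) / (1 - \<epsilon>) < \<alpha> + \<kappa> / 2"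
    using \<kappa> by (intro order_tendstoD(2)) auto
  moreover have "\<forall>\<^sub>F \<epsilon> in at_right 0. \<epsilon> \<in> {0<..<1::real}"
    by (intro eventually_at_right_real) simp
  ultimately have "\<forall>\<^sub>F \<epsilon> in at_right 0. (\<alpha> + \<kappa> / 4 + \<epsilon> * (1 + c * B)) / (1 - \<epsilon>) < \<alpha> + \<kappa> / 2 \<and> \<epsilon> \<in> {0<..<1::real}"
    by (rule eventually_conj)
  then obtain \<epsilon> where \<epsilon>: "0 < \<epsilon>" "\<epsilon> < 1"
    "(\<alpha> + \<kappa> / 4 + \<epsilon> * (1 + c * B)) / (1 - \<epsilon>) < \<alpha> + \<kappa> / 2"
    using eventually_happens'[of "at_right (0::real)"] by (auto simp: trivial_limit_at_right_real)
  have k4: "0 < \<kappa> / 4" using \<kappa> by simp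
  obtain x R where x: "x \<in> strategies R"
    "\<forall>z\<in>Zs. \<forall>a'\<in>D. payoff \<beta> c \<eta> q x (z, (1 - \<epsilon>) *\<^sub>R a' + \<epsilon> *\<^sub>R q) \<le> \<alpha> + \<kappa> / 4"
    by (rule strategy_minimax[OF lam eta ratio beta c q \<epsilon>(1,2) k4 Zs])
  obtain P W where eq: "x = (P, W)" by fastforce
  note PW = strategiesD[OF x(1)[unfolded eq]]
  have pay: "payoff \<beta> c \<eta> q (P, W) (z, a') \<le> \<alpha> + \<kappa> / 2" if "z \<in> Zs" "a' \<in> D" for z a'
  proof -
    have "(1 - \<epsilon>) * payoff \<beta> c \<eta> q x (z, a') + \<epsilon> * payoff \<beta> c \<eta> q x (z, q) \<le> \<alpha> + \<kappa> / 4"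
      using x(2) that by (simp add: payoff_shrink)
    moreover have "\<epsilon> * - (1 + c * B) \<le> \<epsilon> * payoff \<beta> c \<eta> q x (z, q)"
      using \<epsilon>(1) payoff_at_q_ge[OF x(1) that(1) q(1) c0 eta, of \<beta> B] B[OF that(1)]
      by (intro mult_left_mono) auto
    ultimately have "payoff \<beta> c \<eta> q x (z, a') * (1 - \<epsilon>) \<le> \<alpha> + \<kappa> / 4 + \<epsilon> * (1 + c * B)"
      by (simp add: algebra_simps)
    then have "payoff \<beta> c \<eta> q x (z, a') \<le> (\<alpha> + \<kappa> / 4 + \<epsilon> * (1 + c * B)) / (1 - \<epsilon>)"
      using \<epsilon>(2) by (simp only: pos_le_divide_eq diff_gt_0_iff_gt)
    then show ?thesis using \<epsilon>(3) eq by simp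
  qed
  obtain K where K: "\<forall>z\<in>Zs. \<forall>a'\<in>D. \<forall>a\<in>A. \<forall>v\<in>epi R. cost \<beta> c \<eta> q (z, a') a v \<le> K"
    by (rule cost_bounded[OF c0 eta beta])
  have n: "0 < real (card A)" using card_actions by simp
  \<comment> \<open>In contrast \<open>K\<close> depends on \<open>R\<close>, so
    \<open>\<delta>\<close> is chosen after the strategy. Only \<open>P\<close> is mixed;
    \<open>W\<close> stays the same, which keeps the payoff affine in
    \<open>\<delta>\<close>.\<close>
  have "((\<lambda>\<delta>. (1 - \<delta>) * (\<alpha> + \<kappa> / 2) + \<delta> * K) \<longlongrightarrow> (1 - 0) * (\<alpha> + \<kappa> / 2) + 0 * K) (at_right 0)"
    by (intro tendsto_intros)
  then have "\<forall>\<^sub>F \<delta> in at_right 0. (1 - \<delta>) * (\<alpha> + \<kappa> / 2) + \<delta> * K < \<alpha> + \<kappa>"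
    using \<kappa> by (intro order_tendstoD(2)) auto
  moreover have "\<forall>\<^sub>F \<delta> in at_right 0. \<delta> \<in> {0<..<1::real}"
    by (intro eventually_at_right_real) simp
  ultimately have "\<forall>\<^sub>F \<delta> in at_right 0. (1 - \<delta>) * (\<alpha> + \<kappa> / 2) + \<delta> * K < \<alpha> + \<kappa> \<and> \<delta> \<in> {0<..<1::real}"
    by (rule eventually_conj)
  then obtain \<delta> where \<delta>: "0 < \<delta>" "\<delta> < 1" "(1 - \<delta>) * (\<alpha> + \<kappa> / 2) + \<delta> * K < \<alpha> + \<kappa>"
    using eventually_happens'[of "at_right (0::real)"] by (auto simp: trivial_limit_at_right_real)
  define P' where "P' a = (1 - \<delta>) * P a + \<delta> * (1 / real (card A))" for a
  have pos: "0 < P' a" for a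
  proof -
    have "0 \<le> (1 - \<delta>) * P a" using PW(1)[of a] \<delta>(2) by simp
    moreover have "0 < \<delta> * (1 / real (card A))" using \<delta>(1) n by simp
    ultimately show ?thesis unfolding P'_def by (rule add_nonneg_pos)
  qed
  show ?thesis
  proof (rule that)
    have "1 / real (card A) \<le> 1" using card_actions by simp
    then have "P' a \<le> 1" for a
      using convex_bound_le[OF PW(2), of "1 / real (card A)" "1 - \<delta>" \<delta>] \<delta> by (auto simp: P'_def)
    moreover have "sum P' A = 1"
      using PW(3) n by (simp add: P'_def sum.distrib sum_distrib_left[symmetric])
    ultimately show "(P', W) \<in> strategies R"
      using pos PW(4) by (simp add: strategies_def less_imp_le)
    show "\<forall>a\<in>A. 0 < P' a" using pos by blast
    show "\<forall>z\<in>Zs. \<forall>a'\<in>D. payoff \<beta> c \<eta> q (P', W) (z, a') \<le> \<alpha> + \<kappa>"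
    proof (intro ballI)
      fix z a' assume za: "z \<in> Zs" "a' \<in> D"
      let ?c = "\<lambda>a. cost \<beta> c \<eta> q (z, a') a (W (a, \<Phi> a z))"
      have "(\<Sum>a\<in>A. 1 / real (card A) * ?c a) \<le> (\<Sum>a\<in>A. 1 / real (card A) * K)"
        using K za PW(4) n by (intro sum_mono mult_left_mono) auto
      also have "\<dots> = K" using n by simp
      finally have "\<delta> * (\<Sum>a\<in>A. 1 / real (card A) * ?c a) \<le> \<delta> * K"
        using \<delta>(1) by (intro mult_left_mono) auto
      moreover have "(1 - \<delta>) * payoff \<beta> c \<eta> q (P, W) (z, a') \<le> (1 - \<delta>) * (\<alpha> + \<kappa> / 2)"
        using pay[OF za] \<delta>(2) by (intro mult_left_mono) auto
      moreover have "payoff \<beta> c \<eta> q (P', W) (z, a') = (1 - \<delta>) * payoff \<beta> c \<eta> q (P, W) (z, a')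
          + \<delta> * (\<Sum>a\<in>A. 1 / real (card A) * ?c a)"
        unfolding payoff_def P'_def fst_conv snd_conv
        by (simp only: distrib_right sum.distrib sum_distrib_left mult.assoc)
      ultimately show "payoff \<beta> c \<eta> q (P', W) (z, a') \<le> \<alpha> + \<kappa>" using \<delta>(3) by linarith
    qed
  qed
qed

end

section \<open>Passage to the infimum over estimators\<close>

theorem theorem16:
  fixes A :: "(real ^ 'd) set"
    and S :: "'s set"
    and Zs :: "'z set"
    and \<Phi> :: "real ^ 'd \<Rightarrow> 'z \<Rightarrow> 's"
    and loss :: "'z \<Rightarrow> real ^ 'd"
    and D :: "(real ^ 'd) set"
    and F :: "real ^ 'd \<Rightarrow> ereal"
    and \<alpha> lam \<eta> :: real
    and \<beta> :: "'z \<Rightarrow> real ^ 'd \<Rightarrow> real"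
    and q :: "real ^ 'd"
  assumes game: "linear_pm_game A S Zs \<Phi> loss D F"
    and beta_nonneg: "\<And>z a. z \<in> Zs \<Longrightarrow> a \<in> A \<Longrightarrow> 0 \<le> \<beta> z a"
    and lam: "lam > 1"
    and ratio: "adaptive_information_ratio A Zs \<Phi> loss D F \<alpha> \<beta> lam"
    and beta_bounded: "\<exists>B. \<forall>z\<in>Zs. \<forall>a\<in>A. \<beta> z a \<le> B"
    and eta: "\<eta> > 0"
    and q: "q \<in> D \<inter> dom_grad F"
  shows "(INF (p, g)\<in>pos_distributions A \<times> estimators A S.
            SUP (a', z)\<in>D \<times> Zs.
              objective A \<Phi> loss F q \<eta> z a' p g
              - ereal ((1 - 1 / lam) * (\<eta> / lam) powr (1 / (lam - 1)) * (\<Sum>a\<in>A. pmf p a * \<beta> z a)))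
         \<le> ereal \<alpha>"
proof -
  interpret linear_pm_game A S Zs \<Phi> loss D F by (rule game)
  obtain B where B: "\<And>z a. z \<in> Zs \<Longrightarrow> a \<in> A \<Longrightarrow> \<beta> z a \<le> B" using beta_bounded by blast
  define c where "c = (1 - 1 / lam) * (\<eta> / lam) powr (1 / (lam - 1))"
  show ?thesis unfolding c_def[symmetric]
  proof (rule ereal_le_epsilon2)
    fix \<kappa> :: real assume \<kappa>: "0 < \<kappa>"
    have "\<exists>p\<in>pos_distributions A. \<exists>g\<in>estimators A S. \<forall>z\<in>Zs. \<forall>a'\<in>D.
        objective A \<Phi> loss F q \<eta> z a' p g - ereal (c * (\<Sum>a\<in>A. pmf p a * \<beta> z a)) \<le> ereal (\<alpha> + \<kappa>)"
    proof (cases "Zs = {}")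
      \<comment> \<open>The minimax theorem presupposes an adversary. Without latent states every
        bound holds vacuously, and it remains to exhibit an admissible pair.\<close>
      case True
      have "A \<noteq> {}" using card_actions by auto
      then have "pmf_of_set A \<in> pos_distributions A"
        using finite_actions by (auto simp: pos_distributions_def distributions_def card_gt_0_iff)
      moreover have "restrict (\<lambda>_. 0) (A \<times> S) \<in> estimators A S" by (simp add: estimators_def)
      ultimately show ?thesis using True by blast
    next
      case False
      obtain P W R where x: "(P, W) \<in> strategies R" and pos: "\<forall>a\<in>A. 0 < P a"
        and le: "\<forall>z\<in>Zs. \<forall>a'\<in>D. payoff \<beta> c \<eta> q (P, W) (z, a') \<le> \<alpha> + \<kappa>"
        by (rule positive_strategy[OF lam eta ratio beta_nonneg B c_def IntD1[OF q] IntD2[OF q] \<kappa> False])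
      obtain p where p: "set_pmf p \<subseteq> A" "\<And>a. a \<in> A \<Longrightarrow> pmf p a = P a"
        using pmf_of_weights[OF finite_actions strategiesD(1)[OF x] strategiesD(3)[OF x]] by metis
      let ?g = "restrict (\<lambda>i. (P (fst i) / \<eta>) *\<^sub>R (grad F q - fst (W i))) (A \<times> S)"
      have "p \<in> pos_distributions A" using p pos by (auto simp: pos_distributions_def distributions_def)
      moreover have "?g \<in> estimators A S" by (simp add: estimators_def)
      moreover have "objective A \<Phi> loss F q \<eta> z a' p ?g - ereal (c * (\<Sum>a\<in>A. pmf p a * \<beta> z a))
          \<le> ereal (\<alpha> + \<kappa>)" if "z \<in> Zs" "a' \<in> D" for z a'
      proof (rule order_trans)
        show "objective A \<Phi> loss F q \<eta> z a' p ?g - ereal (c * (\<Sum>a\<in>A. pmf p a * \<beta> z a))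
            \<le> ereal (payoff \<beta> c \<eta> q (P, W) (z, a'))"
          by (rule objective_le_payoff[OF x bspec[OF pos] p(2) IntD2[OF q] eta that(1) refl])
        show "ereal (payoff \<beta> c \<eta> q (P, W) (z, a')) \<le> ereal (\<alpha> + \<kappa>)"
          using le that by simp
      qed
      ultimately show ?thesis by fast
    qed
    then obtain p g where pg: "p \<in> pos_distributions A" "g \<in> estimators A S"
      "\<And>z a'. z \<in> Zs \<Longrightarrow> a' \<in> D \<Longrightarrow>
        objective A \<Phi> loss F q \<eta> z a' p g - ereal (c * (\<Sum>a\<in>A. pmf p a * \<beta> z a)) \<le> ereal (\<alpha> + \<kappa>)"
      by blast
    show "(INF (p, g)\<in>pos_distributions A \<times> estimators A S. SUP (a', z)\<in>D \<times> Zs.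
        objective A \<Phi> loss F q \<eta> z a' p g - ereal (c * (\<Sum>a\<in>A. pmf p a * \<beta> z a))) \<le> ereal \<alpha> + ereal \<kappa>"
    proof (rule INF_lower2[of "(p, g)"])
      show "(p, g) \<in> pos_distributions A \<times> estimators A S" using pg by simp
      show "(case (p, g) of (p, g) \<Rightarrow> SUP (a', z)\<in>D \<times> Zs.
        objective A \<Phi> loss F q \<eta> z a' p g - ereal (c * (\<Sum>a\<in>A. pmf p a * \<beta> z a))) \<le> ereal \<alpha> + ereal \<kappa>"
        using pg(3) by (auto intro!: SUP_least)
    qed
  qed
qed

end
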